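(* For every nonzero $f\in\ell^2(V,w)$ and every integer $1\le k\le n$ with $\alpha_k>0$, $$\beta(f)\le16\sqrt2\,k\,\frac{\mathcal R^+(f)}{\sqrt{\alpha_k}}.$$ In particular (taking $f$ an eigenvector for $\alpha_1$), $\beta(G)\le 16\sqrt2\,k\,\alpha_1/\sqrt{\alpha_k}$.
   Context: $G=(V,E,w)$ finite undirected, positive edge weights, $n=|V|$, $w(v)=\sum_{u\sim v}w(u,v)\ge1$, $\mathrm{vol}(S)=\sum_{v\in S}w(v)$; $w(E(S))$ is the weight of edges with both endpoints in $S$, $w(E(S,T))$ the weight of edges between disjoint $S,T$. For disjoint $L,R\subseteq V$ with $L\cup R\ne\emptyset$, the bipartiteness ratio is $\beta(L,R)=\frac{2w(E(L))+2w(E(R))+w(E(L\cup R,V\setminus(L\cup R)))}{\mathrm{vol}(L\cup R)}$, and $\beta(G)=\min\beta(L,R)$. For $f\in\mathbb R^V$ and $t>0$, $L_f(t)=\{v:f(v)\le-t\}$, $R_f(t)=\{v:f(v)\ge t\}$, and $\beta(f)=\min\{\beta(L_f(t),R_f(t)):t>0,\ L_f(t)\cup R_f(t)\ne\emptyset\}$. $\mathcal R^+(f)=\sum_{\{u,v\}\in E}w(u,v)(f(u)+f(v))^2/\sum_vw(v)f(v)^2$. $\alpha_1\le\dots\le\alpha_n$ are the eigenvalues of $\mathcal M=I+D^{-1/2}AD^{-1/2}$ ($A$ weighted adjacency matrix, $D$ diagonal degree matrix). *)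

theory Defs
  imports "Jordan_Normal_Form.Char_Poly"
begin

text \<open>Vertex set V = {0..<n}; weighted adjacency w :: nat => nat => real
  (w u v = 0 means no edge).\<close>

definition wgraph :: "nat \<Rightarrow> (nat \<Rightarrow> nat \<Rightarrow> real) \<Rightarrow> bool" where
  "wgraph n w \<longleftrightarrow> (\<forall>u v. w u v = w v u) \<and> (\<forall>u v. 0 \<le> w u v) \<and> (\<forall>v. w v v = 0)
     \<and> (\<forall>u v. (u \<ge> n \<or> v \<ge> n) \<longrightarrow> w u v = 0)"

definition deg :: "nat \<Rightarrow> (nat \<Rightarrow> nat \<Rightarrow> real) \<Rightarrow> nat \<Rightarrow> real" where
  "deg n w v = (\<Sum>u<n. w u v)"

definition vol :: "nat \<Rightarrow> (nat \<Rightarrow> nat \<Rightarrow> real) \<Rightarrow> nat set \<Rightarrow> real" where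
  "vol n w S = (\<Sum>v\<in>S. deg n w v)"

definition wE :: "(nat \<Rightarrow> nat \<Rightarrow> real) \<Rightarrow> nat set \<Rightarrow> real" where
  "wE w S = (\<Sum>(u,v)\<in>{(u,v). u \<in> S \<and> v \<in> S \<and> u < v}. w u v)"

definition wCut :: "(nat \<Rightarrow> nat \<Rightarrow> real) \<Rightarrow> nat set \<Rightarrow> nat set \<Rightarrow> real" where
  "wCut w S T = (\<Sum>u\<in>S. \<Sum>v\<in>T. w u v)"

definition bip_ratio :: "nat \<Rightarrow> (nat \<Rightarrow> nat \<Rightarrow> real) \<Rightarrow> nat set \<Rightarrow> nat set \<Rightarrow> real" where
  "bip_ratio n w L R =
     (2 * wE w L + 2 * wE w R + wCut w (L \<union> R) ({0..<n} - (L \<union> R))) / vol n w (L \<union> R)"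

definition bip_graph :: "nat \<Rightarrow> (nat \<Rightarrow> nat \<Rightarrow> real) \<Rightarrow> real" where
  "bip_graph n w = Inf {bip_ratio n w L R | L R. L \<subseteq> {0..<n} \<and> R \<subseteq> {0..<n} \<and>
       L \<inter> R = {} \<and> L \<union> R \<noteq> {}}"

definition Lset :: "nat \<Rightarrow> (nat \<Rightarrow> real) \<Rightarrow> real \<Rightarrow> nat set" where
  "Lset n f t = {v. v < n \<and> f v \<le> - t}"

definition Rset :: "nat \<Rightarrow> (nat \<Rightarrow> real) \<Rightarrow> real \<Rightarrow> nat set" where
  "Rset n f t = {v. v < n \<and> f v \<ge> t}"

definition bip_fun :: "nat \<Rightarrow> (nat \<Rightarrow> nat \<Rightarrow> real) \<Rightarrow> (nat \<Rightarrow> real) \<Rightarrow> real" where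
  "bip_fun n w f = Inf {bip_ratio n w (Lset n f t) (Rset n f t) | t.
       t > 0 \<and> Lset n f t \<union> Rset n f t \<noteq> {}}"

definition rayleigh_plus :: "nat \<Rightarrow> (nat \<Rightarrow> nat \<Rightarrow> real) \<Rightarrow> (nat \<Rightarrow> real) \<Rightarrow> real" where
  "rayleigh_plus n w f =
     (\<Sum>(u,v)\<in>{(u,v). u < n \<and> v < n \<and> u < v}. w u v * (f u + f v)^2)
       / (\<Sum>v<n. deg n w v * (f v)^2)"

definition signless_norm_mat :: "nat \<Rightarrow> (nat \<Rightarrow> nat \<Rightarrow> real) \<Rightarrow> real mat" where
  "signless_norm_mat n w = mat n n (\<lambda>(i,j). (if i = j then 1 else 0)
       + w i j / (sqrt (deg n w i) * sqrt (deg n w j)))"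

definition sorted_eigenvalues :: "real mat \<Rightarrow> real list \<Rightarrow> bool" where
  "sorted_eigenvalues M alphas \<longleftrightarrow> sorted alphas \<and> length alphas = dim_row M \<and>
     char_poly M = (\<Prod>a\<leftarrow>alphas. [:- a, 1:])"

end

theory Submission
  imports Defs "Jordan_Normal_Form.Schur_Decomposition"
begin

text \<open>Split an interval \<open>[0, M]\<close> containing the values of \<open>\<bar>f\<bar>\<close> by thresholds
  \<open>0 = t\<^sub>0 \<le> t\<^sub>1 \<le> \<dots>\<close>, chosen greedily so that each truncation of \<open>f\<close> to the values between
  two consecutive thresholds (the distance of \<open>\<bar>f\<bar>\<close> to the nearer of them, with the sign of \<open>f\<close>) has
  squared norm at most \<open>4 E / (k \<alpha>\<^sub>k)\<close>, where \<open>E\<close> is the energy of \<open>f\<close>. If \<open>2k\<close> intervals did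
  not reach \<open>M\<close>, all these bounds would be equalities, \<open>k\<close> of the \<open>2k\<close> disjointly supported
  truncations would have energy at most \<open>E / k\<close>, and Courant--Fischer on their span would give
  \<open>\<alpha>\<^sub>k \<le> \<alpha>\<^sub>k / 2\<close>. Now average the sweep cuts at level \<open>s\<close> with weight the distance from \<open>s\<close>
  to the nearest threshold: the averaged volume is at least \<open>N / (8k)\<close> by Cauchy--Schwarz, where
  \<open>N\<close> is the squared norm of \<open>f\<close>, while the averaged numerator is at most
  \<open>E / 2 + 2 E / sqrt \<alpha>\<^sub>k\<close>.\<close>

section \<open>Orthogonal eigenbases and the Courant--Fischer bound\<close>

definition ip :: "nat \<Rightarrow> (nat \<Rightarrow> real) \<Rightarrow> (nat \<Rightarrow> real) \<Rightarrow> real" where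
  "ip n x y = (\<Sum>i<n. x i * y i)"

text \<open>Vectors are total functions of which only the coordinates below \<open>n\<close> matter,
  so membership asks for agreement there only.\<close>

definition lspan :: "nat \<Rightarrow> (nat \<Rightarrow> nat \<Rightarrow> real) \<Rightarrow> nat \<Rightarrow> (nat \<Rightarrow> real) set" where
  "lspan n q m = {x. \<exists>g. \<forall>i<n. x i = (\<Sum>l<m. g l * q l i)}"

lemma ip_commute: "ip n x y = ip n y x"
  by (simp add: ip_def mult.commute)

lemma ip_cong: "(\<And>i. i < n \<Longrightarrow> x i = x' i) \<Longrightarrow> (\<And>i. i < n \<Longrightarrow> y i = y' i) \<Longrightarrow> ip n x y = ip n x' y'"
  by (simp add: ip_def)

lemma ip_diff_right: "ip n x (\<lambda>i. y i - z i) = ip n x y - ip n x z"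
  by (simp add: ip_def algebra_simps sum_subtractf)

lemma ip_add_right: "ip n x (\<lambda>i. y i + z i) = ip n x y + ip n x z"
  by (simp add: ip_def algebra_simps sum.distrib)

lemma ip_scale_right: "ip n x (\<lambda>i. c * y i) = c * ip n x y"
  by (simp add: ip_def algebra_simps sum_distrib_left)

lemma ip_sum_right: "ip n x (\<lambda>i. \<Sum>l\<in>S. g l * y l i) = (\<Sum>l\<in>S. g l * ip n x (y l))"
  unfolding ip_def sum_distrib_left
  by (subst sum.swap) (simp add: mult.left_commute)

lemma ip_pos: "i < n \<Longrightarrow> x i \<noteq> 0 \<Longrightarrow> ip n x x > 0"
  unfolding ip_def by (rule sum_pos2[of _ i]) (auto simp: zero_less_mult_iff)

lemma ip_self_pos: "ip n z x \<noteq> 0 \<Longrightarrow> ip n x x > 0"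
proof -
  assume "ip n z x \<noteq> 0"
  then obtain i where "i < n" "z i * x i \<noteq> 0" unfolding ip_def using sum.not_neutral_contains_not_neutral by force
  then show ?thesis using ip_pos[of i n x] by simp
qed

lemma ip_self_adjoint:
  assumes "\<And>i j. i < n \<Longrightarrow> j < n \<Longrightarrow> a i j = a j i"
  shows "ip n (\<lambda>i. \<Sum>l<n. a i l * x l) y = ip n x (\<lambda>i. \<Sum>l<n. a i l * y l)"
  unfolding ip_def sum_distrib_right sum_distrib_left
  by (subst sum.swap) (auto intro!: sum.cong simp: assms)

lemma lspan_add: "x \<in> lspan n q m \<Longrightarrow> y \<in> lspan n q m \<Longrightarrow> (\<lambda>i. x i + y i) \<in> lspan n q m"
proof -
  assume "x \<in> lspan n q m" "y \<in> lspan n q m"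
  then obtain g h where "\<forall>i<n. x i = (\<Sum>l<m. g l * q l i)" "\<forall>i<n. y i = (\<Sum>l<m. h l * q l i)"
    by (auto simp: lspan_def)
  then have "\<forall>i<n. x i + y i = (\<Sum>l<m. (g l + h l) * q l i)"
    by (simp add: algebra_simps sum.distrib)
  then show ?thesis unfolding lspan_def by (intro CollectI exI[of _ "\<lambda>l. g l + h l"]) auto
qed

lemma lspan_scale: "x \<in> lspan n q m \<Longrightarrow> (\<lambda>i. c * x i) \<in> lspan n q m"
proof -
  assume "x \<in> lspan n q m"
  then obtain g where "\<forall>i<n. x i = (\<Sum>l<m. g l * q l i)" by (auto simp: lspan_def)
  then have "\<forall>i<n. c * x i = (\<Sum>l<m. (c * g l) * q l i)"
    by (simp add: algebra_simps sum_distrib_left)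
  then show ?thesis unfolding lspan_def by (intro CollectI exI[of _ "\<lambda>l. c * g l"]) auto
qed

lemma lspan_sum:
  "finite S \<Longrightarrow> (\<And>s. s \<in> S \<Longrightarrow> x s \<in> lspan n q m) \<Longrightarrow> (\<lambda>i. \<Sum>s\<in>S. c s * x s i) \<in> lspan n q m"
proof (induction S rule: finite_induct)
  case empty
  then show ?case by (auto simp: lspan_def intro!: exI[of _ "\<lambda>_. 0"])
next
  case (insert s S)
  then show ?case by (simp add: lspan_add lspan_scale)
qed

lemma lspan_base:
  assumes "l < m" shows "q l \<in> lspan n q m"
proof -
  have "(\<Sum>j<m. (if j = l then 1 else 0) * q j i) = q l i" for i
  proof -
    have "(\<Sum>j<m. (if j = l then 1 else 0) * q j i) = (\<Sum>j<m. if j = l then q j i else 0)"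
      by (rule sum.cong) auto
    then show ?thesis using assms by simp
  qed
  then show ?thesis unfolding lspan_def by (intro CollectI exI[of _ "\<lambda>j. if j = l then 1 else 0"]) simp
qed

lemma lspan_trans:
  assumes "x \<in> lspan n p m" "\<And>l. l < m \<Longrightarrow> p l \<in> lspan n q m'"
  shows "x \<in> lspan n q m'"
proof -
  obtain g where g: "\<forall>i<n. x i = (\<Sum>l<m. g l * p l i)" using assms(1) by (auto simp: lspan_def)
  have "(\<lambda>i. \<Sum>l<m. g l * p l i) \<in> lspan n q m'"
    by (rule lspan_sum) (use assms(2) in auto)
  then show ?thesis using g by (simp add: lspan_def)
qed

lemma lspan_mono:
  assumes "x \<in> lspan n q m" "m \<le> m'" shows "x \<in> lspan n q m'"
  by (rule lspan_trans[OF assms(1)]) (use assms(2) in \<open>auto intro: lspan_base\<close>)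

text \<open>Gram--Schmidt applied to a flag of invariant subspaces of a self-adjoint operator: each
  invariant subspace has an invariant orthogonal complement inside the next one, so the
  orthogonalised vectors are eigenvectors. The functionals \<open>Q\<close> dual to \<open>p\<close> only serve
  to see that they do not vanish.\<close>

lemma triangular_orthogonal_eigenvectors:
  assumes sym: "\<And>i j. i < n \<Longrightarrow> j < n \<Longrightarrow> a i j = a j i"
    and tri: "\<And>j i. j < n \<Longrightarrow> i < n \<Longrightarrow> (\<Sum>l<n. a i l * p j l) = (\<Sum>l\<le>j. B l j * p l i)"
    and dual: "\<And>r j. r < n \<Longrightarrow> j < n \<Longrightarrow> ip n (Q r) (p j) = (if r = j then 1 else 0)"
    and "m \<le> n"
  shows "\<exists>q. \<forall>j<m. (\<forall>i<n. (\<Sum>l<n. a i l * q j l) = B j j * q j i) \<and> (\<forall>i<j. ip n (q i) (q j) = 0)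
    \<and> (\<forall>r<n. j \<le> r \<longrightarrow> ip n (Q r) (q j) = (if r = j then 1 else 0)) \<and> p j \<in> lspan n q (Suc j)"
  using \<open>m \<le> n\<close>
proof (induction m)
  case 0
  then show ?case by simp
next
  case (Suc m)
  then obtain q where "\<forall>j<m. (\<forall>i<n. (\<Sum>l<n. a i l * q j l) = B j j * q j i)
      \<and> (\<forall>i<j. ip n (q i) (q j) = 0)
      \<and> (\<forall>r<n. j \<le> r \<longrightarrow> ip n (Q r) (q j) = (if r = j then 1 else 0)) \<and> p j \<in> lspan n q (Suc j)"
    by auto
  then have q: "\<And>j. j < m \<Longrightarrow> \<forall>i<n. (\<Sum>l<n. a i l * q j l) = B j j * q j i"
      "\<And>j i. j < m \<Longrightarrow> i < j \<Longrightarrow> ip n (q i) (q j) = 0"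
      "\<And>j r. j < m \<Longrightarrow> r < n \<Longrightarrow> j \<le> r \<Longrightarrow> ip n (Q r) (q j) = (if r = j then 1 else 0)"
      "\<And>j. j < m \<Longrightarrow> p j \<in> lspan n q (Suc j)"
    by blast+
  have m: "m < n" using Suc.prems by simp
  have orth: "ip n (q i) (q j) = 0" if "i < m" "j < m" "i \<noteq> j" for i j
    using that q(2)[of i j] q(2)[of j i] ip_commute[of n "q i" "q j"] by (cases i j rule: linorder_cases) auto
  have pos: "ip n (q j) (q j) > 0" if "j < m" for j
  proof -
    have "ip n (Q j) (q j) = 1" using q(3)[of j j] that m by simp
    then show ?thesis using ip_self_pos[of n "Q j" "q j"] by simp
  qed
  define c where "c l = ip n (q l) (p m) / ip n (q l) (q l)" for l
  define z where "z = (\<lambda>i. p m i - (\<Sum>l<m. c l * q l i))"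
  have zorth: "ip n (q j) z = 0" if "j < m" for j
  proof -
    have "(\<Sum>l<m. c l * ip n (q j) (q l)) = (\<Sum>l<m. if l = j then c j * ip n (q j) (q j) else 0)"
      by (rule sum.cong) (use orth that in auto)
    also have "\<dots> = ip n (q j) (p m)"
      using that pos[OF that] by (simp add: c_def)
    finally show ?thesis unfolding z_def ip_diff_right ip_sum_right by simp
  qed
  \<comment> \<open>For \<open>r\<close> at least \<open>m\<close>, \<open>Q r\<close> kills all
    earlier \<open>q l\<close>, so \<open>z\<close> takes over the values of \<open>p m\<close>. In
    particular \<open>Q m\<close> sends \<open>z\<close> to 1, whence \<open>z\<close> is
    nonzero.\<close>
  have zQ: "ip n (Q r) z = (if r = m then 1 else 0)" if "r < n" "m \<le> r" for r
  proof -
    have "(\<Sum>l<m. c l * ip n (Q r) (q l)) = 0"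
      by (rule sum.neutral) (use q(3) that in auto)
    then show ?thesis unfolding z_def ip_diff_right ip_sum_right using dual that m by simp
  qed
  \<comment> \<open>Triangularity places the image of \<open>p m\<close>, up to \<open>B m m\<close>
    times \<open>p m\<close>, in the span of the earlier \<open>p l\<close>, and the subtracted
    \<open>q l\<close> are already eigenvectors; so the defect of \<open>z\<close> from being an
    eigenvector lies in the earlier span.\<close>
  have "(\<lambda>i. (\<Sum>l<n. a i l * z l) - B m m * z i) \<in> lspan n q m"
  proof -
    have p: "p l \<in> lspan n q m" if "l < m" for l
      using lspan_mono[OF q(4)[OF that]] that by simp
    have eq: "(\<Sum>l<n. a i l * z l) - B m m * z i =
      (\<Sum>l<m. B l m * p l i) + (\<Sum>l<m. (B m m * c l - c l * B l l) * q l i)" if i: "i < n" for i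
    proof -
      have "(\<Sum>l<n. a i l * z l) = (\<Sum>l<n. a i l * p m l) - (\<Sum>l<n. \<Sum>r<m. a i l * (c r * q r l))"
        unfolding z_def by (simp add: right_diff_distrib sum_subtractf sum_distrib_left)
      also have "(\<Sum>l<n. \<Sum>r<m. a i l * (c r * q r l)) = (\<Sum>r<m. c r * (\<Sum>l<n. a i l * q r l))"
        by (subst sum.swap) (simp add: sum_distrib_left mult.left_commute)
      also have "\<dots> = (\<Sum>r<m. c r * (B r r * q r i))"
        by (rule sum.cong) (use q(1) i in auto)
      also have "(\<Sum>l<n. a i l * p m l) = (\<Sum>l<m. B l m * p l i) + B m m * p m i"
        using tri[OF m i] by (simp add: lessThan_Suc_atMost[symmetric])
      finally show ?thesis unfolding z_def
        by (simp add: algebra_simps sum_subtractf sum_distrib_left)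
    qed
    have "(\<lambda>i. (\<Sum>l<m. B l m * p l i) + (\<Sum>l<m. (B m m * c l - c l * B l l) * q l i)) \<in> lspan n q m"
      by (intro lspan_add lspan_sum) (auto intro: p lspan_base)
    then show ?thesis using eq by (simp add: lspan_def)
  qed
  then obtain e where e: "\<And>i. i < n \<Longrightarrow> (\<Sum>l<n. a i l * z l) - B m m * z i = (\<Sum>l<m. e l * q l i)"
    by (auto simp: lspan_def)
  \<comment> \<open>Self-adjointness moves the operator onto the eigenvector \<open>q j\<close>,
    which is orthogonal to \<open>z\<close>. So the defect is orthogonal to every \<open>q j\<close>
    while lying in their span, and its coefficients vanish.\<close>
  have e0: "e j = 0" if "j < m" for j
  proof -
    have "ip n (q j) (\<lambda>i. \<Sum>l<n. a i l * z l) = ip n (\<lambda>i. \<Sum>l<n. a i l * q j l) z"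
      using ip_self_adjoint[of n a "q j" z] sym by simp
    also have "\<dots> = ip n (\<lambda>i. B j j * q j i) z"
      by (rule ip_cong) (use q(1)[OF that] in auto)
    also have "\<dots> = 0"
      using zorth[OF that] by (subst ip_commute) (simp add: ip_scale_right ip_commute)
    finally have "ip n (q j) (\<lambda>i. (\<Sum>l<n. a i l * z l) - B m m * z i) = 0"
      using zorth[OF that] by (simp add: ip_diff_right ip_scale_right)
    moreover have "ip n (q j) (\<lambda>i. (\<Sum>l<n. a i l * z l) - B m m * z i) = ip n (q j) (\<lambda>i. \<Sum>l<m. e l * q l i)"
      by (rule ip_cong) (use e in auto)
    moreover have "\<dots> = (\<Sum>l<m. if l = j then e j * ip n (q j) (q j) else 0)"
      unfolding ip_sum_right by (rule sum.cong) (use orth that in auto)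
    ultimately show ?thesis using that pos[OF that] by simp
  qed
  have zeig: "\<forall>i<n. (\<Sum>l<n. a i l * z l) = B m m * z i"
    using e e0 by simp
  have sp: "p m \<in> lspan n (q(m := z)) (Suc m)"
  proof -
    have "p m i = (\<Sum>l<Suc m. (c(m := 1)) l * (q(m := z)) l i)" for i
    proof -
      have "(\<Sum>l<m. (c(m := 1)) l * (q(m := z)) l i) = (\<Sum>l<m. c l * q l i)"
        by (rule sum.cong) auto
      then show ?thesis by (simp add: z_def)
    qed
    then show ?thesis unfolding lspan_def by blast
  qed
  have sp': "p j \<in> lspan n (q(m := z)) (Suc j)" if "j < m" for j
  proof -
    have "(\<Sum>l<Suc j. g l * (q(m := z)) l i) = (\<Sum>l<Suc j. g l * q l i)" for g i
      by (rule sum.cong) (use that in auto)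
    then show ?thesis using q(4)[OF that] unfolding lspan_def by simp
  qed
  show ?case
  proof (rule exI[of _ "q(m := z)"], intro allI impI)
    fix j assume "j < Suc m"
    then consider "j < m" | "j = m" by linarith
    then show "(\<forall>i<n. (\<Sum>l<n. a i l * (q(m := z)) j l) = B j j * (q(m := z)) j i)
      \<and> (\<forall>i<j. ip n ((q(m := z)) i) ((q(m := z)) j) = 0)
      \<and> (\<forall>r<n. j \<le> r \<longrightarrow> ip n (Q r) ((q(m := z)) j) = (if r = j then 1 else 0))
      \<and> p j \<in> lspan n (q(m := z)) (Suc j)"
    proof cases
      case 1
      then show ?thesis using q(1-3) sp' by auto
    next
      case 2
      then show ?thesis using zeig zorth zQ sp by auto
    qed
  qed
qed

text \<open>Since the characteristic polynomial splits over the reals, there is a real Schur form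
  \<open>P * B * Q\<close> with the list \<open>es\<close> on the diagonal of \<open>B\<close> in
  the given order. The columns of \<open>P\<close> form the invariant flag, and the rows of
  \<open>Q\<close>, the inverse of \<open>P\<close>, are the dual functionals; orthogonalising the
  flag keeps eigenvalues in order and with multiplicity.\<close>

lemma symmetric_orthogonal_eigenbasis:
  fixes a :: "nat \<Rightarrow> nat \<Rightarrow> real"
  assumes sym: "\<And>i j. i < n \<Longrightarrow> j < n \<Longrightarrow> a i j = a j i"
    and cp: "char_poly (mat n n (\<lambda>(i,j). a i j)) = (\<Prod>e\<leftarrow>es. [:- e, 1:])"
  obtains q where "\<And>j i. j < n \<Longrightarrow> i < n \<Longrightarrow> (\<Sum>l<n. a i l * q j l) = es ! j * q j i"
    "\<And>i j. i < n \<Longrightarrow> j < n \<Longrightarrow> i \<noteq> j \<Longrightarrow> ip n (q i) (q j) = 0"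
    "\<And>j. j < n \<Longrightarrow> ip n (q j) (q j) > 0"
    "\<And>x. x \<in> lspan n q n"
proof -
  let ?A = "mat n n (\<lambda>(i,j). a i j)"
  have A: "?A \<in> carrier_mat n n" by simp
  obtain B P Q where sd: "schur_decomposition ?A es = (B,P,Q)" by (cases "schur_decomposition ?A es") auto
  from schur_decomposition[OF A cp sd]
  have sim: "similar_mat_wit ?A B P Q" and ut: "upper_triangular B" and dg: "diag_mat B = es" by auto
  from similar_mat_witD2[OF A sim]
  have PQ: "P * Q = 1\<^sub>m n" and QP: "Q * P = 1\<^sub>m n" and APBQ: "?A = P * B * Q"
    and B: "B \<in> carrier_mat n n" and P: "P \<in> carrier_mat n n" and Q: "Q \<in> carrier_mat n n" by auto
  have AP: "?A * P = P * B"
  proof -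
    have "?A * P = P * B * (Q * P)" unfolding APBQ using B P Q by (simp add: assoc_mult_mat[of _ n n _ n _ n])
    then show ?thesis using QP B P by simp
  qed
  define p where "p j i = P $$ (i,j)" for j i
  have ent: "(X * Y) $$ (i,j) = (\<Sum>l<n. X $$ (i,l) * Y $$ (l,j))"
    if "X \<in> carrier_mat n n" "Y \<in> carrier_mat n n" "i < n" "j < n" for X Y :: "real mat" and i j
    using that by (simp add: scalar_prod_def atLeast0LessThan)
  have tri: "(\<Sum>l<n. a i l * p j l) = (\<Sum>l\<le>j. B $$ (l,j) * p l i)" if "j < n" "i < n" for i j
  proof -
    have "(\<Sum>l<n. a i l * p j l) = (?A * P) $$ (i,j)"
      by (subst ent[OF A P that(2,1)]) (auto simp: p_def that intro!: sum.cong)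
    also have "\<dots> = (\<Sum>l<n. P $$ (i,l) * B $$ (l,j))" unfolding AP by (rule ent[OF P B that(2,1)])
    also have "\<dots> = (\<Sum>l\<le>j. P $$ (i,l) * B $$ (l,j))"
      by (rule sum.mono_neutral_right) (use that ut B in \<open>auto simp: upper_triangular_def\<close>)
    finally show ?thesis by (simp add: p_def mult.commute)
  qed
  have dual: "ip n (\<lambda>i. Q $$ (r,i)) (p j) = (if r = j then 1 else 0)" if "r < n" "j < n" for r j
    using ent[OF Q P that] that unfolding QP ip_def p_def by simp
  obtain q where "\<forall>j<n. (\<forall>i<n. (\<Sum>l<n. a i l * q j l) = B $$ (j,j) * q j i)
      \<and> (\<forall>i<j. ip n (q i) (q j) = 0)
      \<and> (\<forall>r<n. j \<le> r \<longrightarrow> ip n (\<lambda>i. Q $$ (r,i)) (q j) = (if r = j then 1 else 0))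
      \<and> p j \<in> lspan n q (Suc j)"
    using triangular_orthogonal_eigenvectors[of n a p "\<lambda>l j. B $$ (l,j)" "\<lambda>r i. Q $$ (r,i)" n]
      sym tri dual by auto
  then have q: "\<And>j i. j < n \<Longrightarrow> i < n \<Longrightarrow> (\<Sum>l<n. a i l * q j l) = B $$ (j,j) * q j i"
      "\<And>j i. j < n \<Longrightarrow> i < j \<Longrightarrow> ip n (q i) (q j) = 0"
      "\<And>j r. j < n \<Longrightarrow> r < n \<Longrightarrow> j \<le> r \<Longrightarrow> ip n (\<lambda>i. Q $$ (r,i)) (q j) = (if r = j then 1 else 0)"
      "\<And>j. j < n \<Longrightarrow> p j \<in> lspan n q (Suc j)"
    by blast+
  show ?thesis
  proof (rule that[of q])
    show "(\<Sum>l<n. a i l * q j l) = es ! j * q j i" if "j < n" "i < n" for j i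
      using q(1)[OF that] dg that B by (auto simp: diag_mat_def)
    show "ip n (q i) (q j) = 0" if "i < n" "j < n" "i \<noteq> j" for i j
      using that q(2)[of i j] q(2)[of j i] ip_commute[of n "q i" "q j"] by (cases i j rule: linorder_cases) auto
    show "ip n (q j) (q j) > 0" if "j < n" for j
    proof -
      have "ip n (\<lambda>i. Q $$ (j,i)) (q j) = 1" using q(3)[of j j] that by simp
      then show ?thesis using ip_self_pos[of n "\<lambda>i. Q $$ (j,i)" "q j"] by simp
    qed
    show "x \<in> lspan n q n" for x
    proof (rule lspan_trans[of x n p n])
      show "p l \<in> lspan n q n" if "l < n" for l
        using lspan_mono[OF q(4)[OF that]] that by simp
      \<comment> \<open>The coordinates of \<open>x\<close> in the columns of \<open>P\<close> are
        the entries of \<open>Q\<close> applied to \<open>x\<close>, because \<open>P * Q\<close> is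
        the identity.\<close>
      have "x i = (\<Sum>l<n. (\<Sum>r<n. Q $$ (l,r) * x r) * p l i)" if i: "i < n" for i
      proof -
        have "(\<Sum>l<n. (\<Sum>r<n. Q $$ (l,r) * x r) * p l i) = (\<Sum>r<n. (\<Sum>l<n. P $$ (i,l) * Q $$ (l,r)) * x r)"
          unfolding sum_distrib_right p_def by (subst sum.swap) (simp add: mult_ac)
        also have "\<dots> = (\<Sum>r<n. if r = i then x i else 0)"
        proof (rule sum.cong)
          fix r assume "r \<in> {..<n}"
          then show "(\<Sum>l<n. P $$ (i,l) * Q $$ (l,r)) * x r = (if r = i then x i else 0)"
            using ent[OF P Q i, of r] i unfolding PQ by auto
        qed simp
        finally show ?thesis using i by simp
      qed
      then show "x \<in> lspan n p n" unfolding lspan_def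
        by (intro CollectI exI[of _ "\<lambda>l. \<Sum>r<n. Q $$ (l,r) * x r"] allI impI)
    qed
  qed
qed

text \<open>With fewer equations than unknowns a nonzero solution exists: a zero row pads the system
  to a square matrix, whose determinant vanishes.\<close>

lemma underdetermined_kernel:
  fixes b :: "nat \<Rightarrow> nat \<Rightarrow> real"
  assumes "1 \<le> k"
  shows "\<exists>c. (\<exists>i<k. c i \<noteq> 0) \<and> (\<forall>l<k-1. (\<Sum>i<k. c i * b l i) = 0)"
proof -
  let ?Z = "mat k k (\<lambda>(l,i). if l < k - 1 then b l i else 0)"
  have Z: "?Z \<in> carrier_mat k k" by simp
  have "(\<Prod>i = 0..<k. ?Z $$ (p i, i)) = 0" if "p permutes {0..<k}" for p
  proof -
    \<comment> \<open>Every permutation hits the zero row \<open>k - 1\<close>, so each product in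
      the Leibniz expansion has a zero factor.\<close>
    have "k - 1 \<in> p ` {0..<k}" using permutes_image[OF that] assms by auto
    then obtain i where "i < k" "p i = k - 1" by auto
    then have "?Z $$ (p i, i) = 0" using assms by simp
    then show ?thesis using \<open>i < k\<close> by (intro prod_zero) auto
  qed
  then have "det ?Z = 0" unfolding det_col[OF Z] by (intro sum.neutral ballI) (simp only: mem_Collect_eq mult_zero_right flip: atLeast0LessThan)
  then obtain v where v: "v \<in> carrier_vec k" "v \<noteq> 0\<^sub>v k" "?Z *\<^sub>v v = 0\<^sub>v k"
    using det_0_iff_vec_prod_zero[OF Z] by auto
  have nz: "\<exists>i<k. v $ i \<noteq> 0"
  proof (rule ccontr)
    assume "\<not> ?thesis"
    then have "v = 0\<^sub>v k" using v(1) by (intro eq_vecI) auto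
    then show False using v(2) by simp
  qed
  have "(\<Sum>i<k. v $ i * b l i) = 0" if "l < k - 1" for l
  proof -
    have "(?Z *\<^sub>v v) $ l = 0" using v(3) that by simp
    then show ?thesis using that v(1) by (simp add: scalar_prod_def atLeast0LessThan mult.commute)
  qed
  then show ?thesis using nz by (intro exI[of _ "\<lambda>i. v $ i"]) auto
qed

text \<open>A \<open>k\<close>-dimensional space contains a nonzero vector orthogonal to the first
  \<open>k - 1\<close> eigenvectors, and on such vectors the form is at least the
  \<open>k\<close>-th eigenvalue times the squared norm. The list is indexed from 0, so that
  eigenvalue is \<open>alphas ! (k - 1)\<close>.\<close>

lemma courant_fischer_upper:
  fixes a :: "nat \<Rightarrow> nat \<Rightarrow> real" and y :: "nat \<Rightarrow> nat \<Rightarrow> real"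
  assumes sym: "\<And>i j. i < n \<Longrightarrow> j < n \<Longrightarrow> a i j = a j i"
    and eig: "sorted_eigenvalues (mat n n (\<lambda>(i,j). a i j)) alphas"
    and k: "1 \<le> k" "k \<le> n"
    and indep: "\<And>c. \<exists>l<k. c l \<noteq> 0 \<Longrightarrow> \<exists>i<n. (\<Sum>l<k. c l * y l i) \<noteq> 0"
    and form: "\<And>c x. x = (\<lambda>i. \<Sum>l<k. c l * y l i) \<Longrightarrow>
      ip n x (\<lambda>i. \<Sum>j<n. a i j * x j) \<le> lam * ip n x x"
  shows "alphas ! (k - 1) \<le> lam"
proof -
  from eig have srt: "sorted alphas" and len: "length alphas = n"
    and cp: "char_poly (mat n n (\<lambda>(i,j). a i j)) = (\<Prod>e\<leftarrow>alphas. [:- e, 1:])"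
    by (auto simp: sorted_eigenvalues_def)
  obtain q where q: "\<And>j i. j < n \<Longrightarrow> i < n \<Longrightarrow> (\<Sum>l<n. a i l * q j l) = alphas ! j * q j i"
    and orth: "\<And>i j. i < n \<Longrightarrow> j < n \<Longrightarrow> i \<noteq> j \<Longrightarrow> ip n (q i) (q j) = 0"
    and pos: "\<And>j. j < n \<Longrightarrow> ip n (q j) (q j) > 0"
    and span: "\<And>x. x \<in> lspan n q n"
    using symmetric_orthogonal_eigenbasis[OF sym cp] by blast
  \<comment> \<open>Orthogonality to the eigenvectors with index below \<open>k - 1\<close> amounts
    to \<open>k - 1\<close> linear conditions on the \<open>k\<close> coefficients.\<close>
  obtain c where c: "\<exists>i<k. c i \<noteq> 0" "\<And>l. l < k - 1 \<Longrightarrow> (\<Sum>i<k. c i * ip n (q l) (y i)) = 0"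
    using underdetermined_kernel[OF k(1), of "\<lambda>l i. ip n (q l) (y i)"] by blast
  define x where "x = (\<lambda>i. \<Sum>l<k. c l * y l i)"
  have xq: "ip n (q l) x = 0" if "l < k - 1" for l
    unfolding x_def ip_sum_right by (rule c(2)[OF that])
  obtain d where d: "\<And>i. i < n \<Longrightarrow> x i = (\<Sum>l<n. d l * q l i)"
    using span[of x] by (auto simp: lspan_def)
  have qx: "ip n (q j) x = d j * ip n (q j) (q j)" if "j < n" for j
  proof -
    have "ip n (q j) x = ip n (q j) (\<lambda>i. \<Sum>l<n. d l * q l i)" by (rule ip_cong) (use d in auto)
    also have "\<dots> = (\<Sum>l<n. if l = j then d j * ip n (q j) (q j) else 0)"
      unfolding ip_sum_right by (rule sum.cong) (use orth that in auto)
    finally show ?thesis using that by simp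
  qed
  have d0: "d l = 0" if "l < k - 1" for l
  proof -
    have l: "l < n" using that k by simp
    then show ?thesis using qx[OF l] xq[OF that] pos[OF l] by simp
  qed
  have xx: "ip n x x = (\<Sum>l<n. d l * (d l * ip n (q l) (q l)))"
  proof -
    have "ip n x x = ip n x (\<lambda>i. \<Sum>l<n. d l * q l i)" by (rule ip_cong) (use d in auto)
    also have "\<dots> = (\<Sum>l<n. d l * (d l * ip n (q l) (q l)))"
      unfolding ip_sum_right by (rule sum.cong) (use qx ip_commute in auto)
    finally show ?thesis .
  qed
  have xax: "ip n x (\<lambda>i. \<Sum>j<n. a i j * x j) = (\<Sum>l<n. d l * (alphas ! l * (d l * ip n (q l) (q l))))"
  proof -
    have "ip n x (\<lambda>i. \<Sum>j<n. a i j * x j) = ip n (\<lambda>i. \<Sum>j<n. a i j * x j) (\<lambda>i. \<Sum>l<n. d l * q l i)"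
      by (subst ip_commute, rule ip_cong) (use d in auto)
    also have "\<dots> = (\<Sum>l<n. d l * ip n (\<lambda>i. \<Sum>j<n. a i j * x j) (q l))"
      by (rule ip_sum_right)
    also have "\<dots> = (\<Sum>l<n. d l * (alphas ! l * (d l * ip n (q l) (q l))))"
    proof (rule sum.cong)
      fix l assume "l \<in> {..<n}"
      then have l: "l < n" by simp
      have "ip n (\<lambda>i. \<Sum>j<n. a i j * x j) (q l) = ip n x (\<lambda>i. \<Sum>j<n. a i j * q l j)"
        by (rule ip_self_adjoint) (rule sym)
      also have "\<dots> = ip n x (\<lambda>i. alphas ! l * q l i)" by (rule ip_cong) (use q l in auto)
      finally show "d l * ip n (\<lambda>i. \<Sum>j<n. a i j * x j) (q l) = d l * (alphas ! l * (d l * ip n (q l) (q l)))"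
        using qx[OF l] by (simp add: ip_scale_right ip_commute)
    qed simp
    finally show ?thesis .
  qed
  \<comment> \<open>Compare the two eigenvector expansions term by term: for
    \<open>l < k - 1\<close> the coefficient is zero, and from there on sortedness gives the
    inequality.\<close>
  have "alphas ! (k-1) * ip n x x \<le> ip n x (\<lambda>i. \<Sum>j<n. a i j * x j)"
    unfolding xx xax sum_distrib_left
  proof (rule sum_mono)
    fix l assume "l \<in> {..<n}"
    then have l: "l < n" by simp
    show "alphas ! (k - 1) * (d l * (d l * ip n (q l) (q l))) \<le> d l * (alphas ! l * (d l * ip n (q l) (q l)))"
    proof (cases "l < k - 1")
      case True
      then show ?thesis using d0 by simp
    next
      case False
      then have "alphas ! (k-1) \<le> alphas ! l" using srt len l by (intro sorted_nth_mono) auto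
      then have "alphas ! (k - 1) * (d l * d l * ip n (q l) (q l)) \<le> alphas ! l * (d l * d l * ip n (q l) (q l))"
        by (rule mult_right_mono) (use pos[OF l] in auto)
      then show ?thesis by (simp add: mult_ac)
    qed
  qed
  also have "\<dots> \<le> lam * ip n x x" by (rule form[OF x_def])
  finally have "alphas ! (k-1) * ip n x x \<le> lam * ip n x x" .
  moreover have "ip n x x > 0"
    using indep[OF c(1)] ip_pos[of _ n x] unfolding x_def by auto
  ultimately show ?thesis by simp
qed

section \<open>Distance to the nearest threshold\<close>

definition tent :: "real \<Rightarrow> real \<Rightarrow> real \<Rightarrow> real" where
  "tent a b x = max 0 (min (x - a) (b - x))"

definition half_sq :: "real \<Rightarrow> real" where
  "half_sq x = (max 0 x)\<^sup>2 / 2"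

text \<open>The antiderivative of \<open>tent a b\<close> that vanishes up to \<open>a\<close>: the
  slope of the tent jumps by 1, -2 and 1 at \<open>a\<close>, the midpoint and \<open>b\<close>, and
  \<open>half_sq\<close> integrates the positive part.\<close>

definition tent_int :: "real \<Rightarrow> real \<Rightarrow> real \<Rightarrow> real" where
  "tent_int a b x = half_sq (x - a) - 2 * half_sq (x - (a + b) / 2) + half_sq (x - b)"

text \<open>For increasing thresholds this is, between \<open>t 0\<close> and \<open>t m\<close>,
  the distance to the nearest threshold.\<close>

definition zigzag :: "(nat \<Rightarrow> real) \<Rightarrow> nat \<Rightarrow> real \<Rightarrow> real" where
  "zigzag t m x = (\<Sum>i<m. tent (t i) (t (Suc i)) x)"

definition zigzag_int :: "(nat \<Rightarrow> real) \<Rightarrow> nat \<Rightarrow> real \<Rightarrow> real" where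
  "zigzag_int t m x = (\<Sum>i<m. tent_int (t i) (t (Suc i)) x)"

text \<open>Used for \<open>g\<close> vanishing on the nonpositive axis, where it is the odd
  extension of \<open>g\<close> from the nonnegative axis; there is no factor 1/2.\<close>

definition odd_part :: "(real \<Rightarrow> real) \<Rightarrow> real \<Rightarrow> real" where
  "odd_part g x = g x - g (- x)"

lemma half_sq_has_derivative [derivative_intros]:
  "(half_sq has_real_derivative max 0 x) (at x)"
proof -
  consider "x > 0" | "x < 0" | "x = 0" by linarith
  then show ?thesis
  proof cases
    case 1
    have "((\<lambda>x. x\<^sup>2 / 2) has_real_derivative max 0 x) (at x)"
      using 1 by (auto intro!: derivative_eq_intros)
    then show ?thesis
      by (rule has_field_derivative_transform_within_open[of _ _ _ "{0<..}"])
        (use 1 in \<open>auto simp: half_sq_def\<close>)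
  next
    case 2
    have "((\<lambda>x. 0) has_real_derivative max 0 x) (at x)" using 2 by simp
    then show ?thesis
      by (rule has_field_derivative_transform_within_open[of _ _ _ "{..<0}"])
        (use 2 in \<open>auto simp: half_sq_def\<close>)
  next
    case 3
    \<comment> \<open>At the kink the difference quotient is bounded by
      \<open>\<bar>h\<bar>\<close>, so the derivative there is 0.\<close>
    have "((\<lambda>h. half_sq h / h) \<longlongrightarrow> 0) (at 0)"
    proof (rule tendsto_0_le[where K = 1])
      show "((\<lambda>h::real. h) \<longlongrightarrow> 0) (at 0)" by (rule tendsto_ident_at)
      show "\<forall>\<^sub>F h in at 0. norm (half_sq h / h) \<le> norm h * 1"
        by (rule always_eventually) (auto simp: half_sq_def max_def power2_eq_square)
    qed
    then show ?thesis using 3 by (simp add: DERIV_def half_sq_def)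
  qed
qed

lemma tent_int_has_derivative:
  assumes "a \<le> b"
  shows "(tent_int a b has_real_derivative tent a b x) (at x)"
proof -
  have "((\<lambda>x. half_sq (x - a) - 2 * half_sq (x - (a + b) / 2) + half_sq (x - b))
      has_real_derivative max 0 (x - a) - 2 * max 0 (x - (a + b) / 2) + max 0 (x - b)) (at x)"
    by (rule derivative_eq_intros DERIV_chain2[OF half_sq_has_derivative] refl | simp)+
  moreover have "max 0 (x - a) - 2 * max 0 (x - (a + b) / 2) + max 0 (x - b) = tent a b x"
    using assms by (simp add: tent_def max_def min_def field_simps)
  ultimately show ?thesis by (simp add: tent_int_def[abs_def])
qed

lemma tent_nonneg: "0 \<le> tent a b x"
  by (simp add: tent_def)

lemma tent_eq_0: "x \<le> a \<or> b \<le> x \<Longrightarrow> tent a b x = 0"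
  by (auto simp: tent_def max_def min_def)

text \<open>The tent has slopes of modulus at most 1 and is constant off \<open>[a, b]\<close>, so
  it varies at most by the length of the part of \<open>[x, y]\<close> inside \<open>[a, b]\<close>.
  Lengths are written with \<open>min\<close> because this form telescopes over consecutive
  thresholds.\<close>

lemma tent_diff_le:
  assumes "a \<le> b" "x \<le> y"
  shows "\<bar>tent a b x - tent a b y\<bar> \<le> (min y b - min y a) - (min x b - min x a)"
  using assms unfolding tent_def by (auto simp: max_def min_def abs_if)

text \<open>The left side is a quarter of the square of the length of \<open>[a, b]\<close> below
  \<open>x\<close>. Up to the midpoint the integral is half that square; beyond it the ratio
  decreases and reaches 1/4 at \<open>b\<close>.\<close>

lemma tent_int_ge:
  assumes "a \<le> b"
  shows "(min x b - min x a)\<^sup>2 / 4 \<le> tent_int a b x"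
proof -
  consider "x \<le> a" | "a < x" "x \<le> (a + b) / 2" | "(a + b) / 2 < x" "x \<le> b" | "b < x" by linarith
  then show ?thesis
  proof cases
    case 1
    then show ?thesis using assms by (simp add: tent_int_def half_sq_def)
  next
    case 2
    then have eq: "tent_int a b x = (x - a)\<^sup>2 / 2" "min x b = x" "min x a = a"
      using assms by (auto simp: tent_int_def half_sq_def)
    show ?thesis unfolding eq using zero_le_power2[of "x - a"] by simp
  next
    case 3
    then have eq: "tent_int a b x = (x - a)\<^sup>2 / 2 - (x - (a + b) / 2)\<^sup>2" "min x b = x" "min x a = a"
      using assms by (auto simp: tent_int_def half_sq_def)
    define s r where "s = x - a" and "r = x - (a + b) / 2"
    \<comment> \<open>The claim is \<open>s^2 / 2 - r^2 \<ge> s^2 / 4\<close>, that is,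
      \<open>2 * r \<le> s\<close>, which is just \<open>x \<le> b\<close>.\<close>
    have "0 \<le> r" "2 * r \<le> s" using 3 assms by (auto simp: s_def r_def field_simps)
    then have "(2 * r) * (2 * r) \<le> s * s" by (intro mult_mono) auto
    then show ?thesis unfolding eq s_def[symmetric] r_def[symmetric]
      by (simp add: power2_eq_square)
  next
    case 4
    then have "tent_int a b x = (x - a)\<^sup>2 / 2 - (x - (a + b) / 2)\<^sup>2 + (x - b)\<^sup>2 / 2"
       "min x b = b" "min x a = a"
      using assms by (auto simp: tent_int_def half_sq_def)
    then show ?thesis by (simp add: power2_eq_square field_simps)
  qed
qed

lemma tents_disjoint:
  assumes "mono t" "i \<noteq> j"
  shows "tent (t i) (t (Suc i)) x * tent (t j) (t (Suc j)) x = 0"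
proof -
  have *: "tent (t i) (t (Suc i)) x * tent (t j) (t (Suc j)) x = 0" if "i < j" for i j
  proof -
    have "t (Suc i) \<le> t j" using assms(1) that by (simp add: mono_def)
    then have "t (Suc i) \<le> x \<or> x \<le> t j" by linarith
    then show ?thesis using tent_eq_0 by auto
  qed
  then show ?thesis using assms(2) by (metis linorder_neqE_nat mult.commute)
qed

lemma sum_sq_orthogonal:
  fixes A :: "nat \<Rightarrow> real"
  assumes "\<And>i j. i < m \<Longrightarrow> j < m \<Longrightarrow> i \<noteq> j \<Longrightarrow> A i * A j = 0"
  shows "(\<Sum>i<m. A i)\<^sup>2 = (\<Sum>i<m. (A i)\<^sup>2)"
  using assms
proof (induction m)
  case (Suc m)
  have "(\<Sum>i<m. A i) * A m = 0"
    unfolding sum_distrib_right by (rule sum.neutral) (use Suc.prems in auto)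
  moreover have "(\<Sum>i<m. A i)\<^sup>2 = (\<Sum>i<m. (A i)\<^sup>2)"
    by (rule Suc.IH) (use Suc.prems in auto)
  ultimately show ?case by (simp add: power2_sum)
qed simp

lemma zigzag_sq:
  assumes "mono t"
  shows "(zigzag t m x)\<^sup>2 = (\<Sum>i<m. (tent (t i) (t (Suc i)) x)\<^sup>2)"
  unfolding zigzag_def by (rule sum_sq_orthogonal) (rule tents_disjoint[OF assms])

lemma zigzag_nonneg: "0 \<le> zigzag t m x"
  unfolding zigzag_def by (intro sum_nonneg tent_nonneg)

lemma zigzag_nonpos_eq_0:
  assumes "mono t" "t 0 = 0" "x \<le> 0"
  shows "zigzag t m x = 0"
  unfolding zigzag_def
proof (rule sum.neutral, rule ballI)
  fix i show "tent (t i) (t (Suc i)) x = 0"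
    using monoD[OF assms(1), of 0 i] assms by (intro tent_eq_0) auto
qed

lemma zigzag_int_has_derivative:
  assumes "mono t"
  shows "(zigzag_int t m has_real_derivative zigzag t m x) (at x)"
proof -
  have "((\<lambda>x. \<Sum>i<m. tent_int (t i) (t (Suc i)) x) has_real_derivative
      (\<Sum>i<m. tent (t i) (t (Suc i)) x)) (at x)"
    by (intro DERIV_sum tent_int_has_derivative monoD[OF assms]) simp
  then show ?thesis by (simp add: zigzag_int_def[abs_def] zigzag_def)
qed

lemma zigzag_int_mono:
  assumes "mono t" "x \<le> y"
  shows "zigzag_int t m x \<le> zigzag_int t m y"
  using assms(2)
  by (rule DERIV_nonneg_imp_nondecreasing) (use zigzag_int_has_derivative[OF assms(1)] zigzag_nonneg in blast)

lemma zigzag_int_nonpos_eq_0: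
  assumes "mono t" "t 0 = 0" "x \<le> 0"
  shows "zigzag_int t m x = 0"
  unfolding zigzag_int_def
proof (rule sum.neutral, rule ballI)
  fix i
  have "0 \<le> t i" "0 \<le> t (Suc i)"
    using monoD[OF assms(1), of 0 i] monoD[OF assms(1), of 0 "Suc i"] assms(2) by auto
  then show "tent_int (t i) (t (Suc i)) x = 0"
    using assms(3) by (simp add: tent_int_def half_sq_def)
qed

text \<open>The thresholds cut \<open>[0, x]\<close> into at most \<open>m\<close> pieces with
  lengths \<open>d i\<close>, each contributing at least \<open>(d i)^2 / 4\<close>; Cauchy--Schwarz
  bounds the sum of squares below by \<open>x^2 / m\<close>.\<close>

lemma zigzag_int_ge:
  assumes "mono t" "t 0 = 0" "0 \<le> x" "x \<le> t m" "0 < m"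
  shows "x\<^sup>2 / (4 * real m) \<le> zigzag_int t m x"
proof -
  define d where "d i = min x (t (Suc i)) - min x (t i)" for i
  have sumd: "(\<Sum>i<m. d i) = x"
    unfolding d_def by (subst sum_lessThan_telescope) (use assms in auto)
  have "x\<^sup>2 \<le> real m * (\<Sum>i<m. (d i)\<^sup>2)"
  proof -
    \<comment> \<open>Cauchy--Schwarz as nonnegativity of the variance about the mean
      \<open>x / m\<close>.\<close>
    have "0 \<le> (\<Sum>i<m. (d i - x / m)\<^sup>2)" by (simp add: sum_nonneg)
    also have "\<dots> = (\<Sum>i<m. (d i)\<^sup>2) - 2 * (x / m) * (\<Sum>i<m. d i) + m * (x / m)\<^sup>2"
      by (simp add: power2_diff sum.distrib sum_subtractf sum_distrib_left sum_divide_distrib mult_ac)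
    also have "\<dots> = (\<Sum>i<m. (d i)\<^sup>2) - x\<^sup>2 / m"
      using \<open>0 < m\<close> by (simp add: sumd power2_eq_square field_simps)
    finally show ?thesis using \<open>0 < m\<close> by (simp add: field_simps)
  qed
  then have "x\<^sup>2 / (4 * real m) \<le> (\<Sum>i<m. (d i)\<^sup>2 / 4)"
    using assms(5) by (simp add: field_simps sum_divide_distrib[symmetric])
  also have "\<dots> \<le> zigzag_int t m x"
    unfolding zigzag_int_def d_def by (intro sum_mono tent_int_ge monoD[OF assms(1)]) simp
  finally show ?thesis .
qed

text \<open>Different truncations vary on disjoint parts of \<open>[x, y]\<close>, so even their
  total variation is at most its length. The energies of all truncations together are thereby
  controlled by that of \<open>f\<close>.\<close>

lemma sum_odd_tents_diff_le:
  assumes "mono t" "t 0 = 0"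
  shows "(\<Sum>i<m. \<bar>odd_part (tent (t i) (t (Suc i))) x - odd_part (tent (t i) (t (Suc i))) y\<bar>) \<le> \<bar>x - y\<bar>"
proof -
  have *: "(\<Sum>i<m. \<bar>odd_part (tent (t i) (t (Suc i))) x - odd_part (tent (t i) (t (Suc i))) y\<bar>) \<le> y - x"
    if "x \<le> y" for x y
  proof -
    let ?d = "\<lambda>x i. min x (t (Suc i)) - min x (t i)"
    have tel: "(\<Sum>i<m. ?d x i) = min x (t m) - min x 0" for x
      using sum_lessThan_telescope[of "\<lambda>i. min x (t i)" m] assms(2) by simp
    have "(\<Sum>i<m. \<bar>odd_part (tent (t i) (t (Suc i))) x - odd_part (tent (t i) (t (Suc i))) y\<bar>)
      \<le> (\<Sum>i<m. (?d y i - ?d x i) + (?d (- x) i - ?d (- y) i))"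
    proof (rule sum_mono)
      fix i
      have "t i \<le> t (Suc i)" using assms(1) by (simp add: mono_def)
      \<comment> \<open>Negation reverses order, so the mirrored tents are compared from
        \<open>- y\<close> up to \<open>- x\<close>.\<close>
      then have "\<bar>tent (t i) (t (Suc i)) x - tent (t i) (t (Suc i)) y\<bar> \<le> ?d y i - ?d x i"
          "\<bar>tent (t i) (t (Suc i)) (- y) - tent (t i) (t (Suc i)) (- x)\<bar> \<le> ?d (- x) i - ?d (- y) i"
        using that by (auto intro!: tent_diff_le)
      moreover have "\<bar>p - r\<bar> \<le> A \<Longrightarrow> \<bar>s - q\<bar> \<le> B \<Longrightarrow> \<bar>(p - q) - (r - s)\<bar> \<le> A + B"
        for p q r s A B :: real by linarith
      ultimately show "\<bar>odd_part (tent (t i) (t (Suc i))) x - odd_part (tent (t i) (t (Suc i))) y\<bar>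
        \<le> (?d y i - ?d x i) + (?d (- x) i - ?d (- y) i)"
        unfolding odd_part_def by blast
    qed
    also have "\<dots> = ((\<Sum>i<m. ?d y i) - (\<Sum>i<m. ?d x i)) + ((\<Sum>i<m. ?d (- x) i) - (\<Sum>i<m. ?d (- y) i))"
      by (simp only: sum.distrib sum_subtractf)
    also have "\<dots> = ((min y (t m) - min y 0) - (min x (t m) - min x 0))
        + ((min (- x) (t m) - min (- x) 0) - (min (- y) (t m) - min (- y) 0))"
      by (simp only: tel)
    \<comment> \<open>The first group measures \<open>[x, y]\<close> within \<open>[0, t m]\<close>,
      the second within \<open>[- t m, 0]\<close>; these do not overlap.\<close>
    also have "\<dots> \<le> y - x"
      using that monoD[OF assms(1), of 0 m] assms(2) by (auto simp: min_def)
    finally show ?thesis .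
  qed
  show ?thesis
  proof (cases "x \<le> y")
    case True
    then show ?thesis using *[of x y] by simp
  next
    case False
    then show ?thesis using *[of y x] by (simp add: abs_minus_commute)
  qed
qed

lemma zigzag_lipschitz:
  assumes "mono t" "t 0 = 0"
  shows "zigzag t m \<bar>x\<bar> \<le> zigzag t m \<bar>y\<bar> + \<bar>x - y\<bar>"
proof -
  \<comment> \<open>At a nonnegative argument the mirrored tent vanishes because all thresholds are
    nonnegative, so the estimate for odd parts applies to the tents themselves.\<close>
  have odd: "odd_part (tent (t i) (t (Suc i))) \<bar>z\<bar> = tent (t i) (t (Suc i)) \<bar>z\<bar>" for i z
    using monoD[OF assms(1), of 0 i] assms(2) tent_eq_0[of "- \<bar>z\<bar>" "t i" "t (Suc i)"] unfolding odd_part_def by linarith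
  have "zigzag t m (abs x) - zigzag t m (abs y) \<le>
    (\<Sum>i<m. abs (odd_part (tent (t i) (t (Suc i))) (abs x) - odd_part (tent (t i) (t (Suc i))) (abs y)))"
    unfolding zigzag_def sum_subtractf[symmetric] odd by (intro sum_mono) simp
  also have "\<dots> \<le> \<bar>\<bar>x\<bar> - \<bar>y\<bar>\<bar>" by (rule sum_odd_tents_diff_le[OF assms])
  finally show ?thesis by linarith
qed

text \<open>The derivative of the odd extension at \<open>z\<close> is
  \<open>zigzag t m \<bar>z\<bar>\<close>, so the mean value theorem reduces the claim to bounding
  this at an intermediate point.\<close>

lemma odd_zigzag_int_diff_le:
  assumes "mono t" "t 0 = 0"
  shows "\<bar>odd_part (zigzag_int t m) x - odd_part (zigzag_int t m) y\<bar>
    \<le> \<bar>x - y\<bar> * (zigzag t m \<bar>x\<bar> + zigzag t m \<bar>y\<bar> + \<bar>x - y\<bar>) / 2"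
proof -
  let ?h = "odd_part (zigzag_int t m)"
  have D: "(?h has_real_derivative zigzag t m \<bar>z\<bar>) (at z)" for z
  proof -
    have "(?h has_real_derivative zigzag t m z + zigzag t m (- z)) (at z)"
    proof -
      have "((\<lambda>x. zigzag_int t m (- x)) has_real_derivative zigzag t m (- z) * (- 1)) (at z)"
        by (rule DERIV_chain2[OF zigzag_int_has_derivative[OF assms(1)]])
          (auto intro!: derivative_eq_intros)
      from DERIV_diff[OF zigzag_int_has_derivative[OF assms(1)] this] show ?thesis
        unfolding odd_part_def[abs_def] by simp
    qed
    moreover have "zigzag t m z + zigzag t m (- z) = zigzag t m \<bar>z\<bar>"
      using zigzag_nonpos_eq_0[OF assms, of z] zigzag_nonpos_eq_0[OF assms, of "- z"]
      by (cases "z \<ge> 0") auto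
    ultimately show ?thesis by simp
  qed
  have *: "\<bar>?h x - ?h y\<bar> \<le> \<bar>x - y\<bar> * (zigzag t m \<bar>x\<bar> + zigzag t m \<bar>y\<bar> + \<bar>x - y\<bar>) / 2" if "x < y" for x y
  proof -
    have "\<exists>z>x. z < y \<and> ?h y - ?h x = (y - x) * zigzag t m \<bar>z\<bar>"
      by (rule MVT2[OF that]) (rule D)
    then obtain z where z: "x < z" "z < y" "?h y - ?h x = (y - x) * zigzag t m \<bar>z\<bar>"
      by blast
    have "2 * zigzag t m \<bar>z\<bar> \<le> zigzag t m \<bar>x\<bar> + zigzag t m \<bar>y\<bar> + (y - x)"
      \<comment> \<open>The Lipschitz bounds from the two endpoints are added; the distances from
        \<open>z\<close> sum to \<open>y - x\<close>, and halving gives the factor 1/2.\<close>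
      using zigzag_lipschitz[OF assms, of m z x] zigzag_lipschitz[OF assms, of m z y] z by linarith
    then have "(y - x) * (2 * zigzag t m \<bar>z\<bar>) \<le> (y - x) * (zigzag t m \<bar>x\<bar> + zigzag t m \<bar>y\<bar> + (y - x))"
      using that by (intro mult_left_mono) auto
    moreover have "\<bar>?h x - ?h y\<bar> = (y - x) * zigzag t m \<bar>z\<bar>"
    proof -
      have "0 \<le> (y - x) * zigzag t m \<bar>z\<bar>" using that zigzag_nonneg[of t m "\<bar>z\<bar>"] by simp
      then show ?thesis using z(3) by linarith
    qed
    ultimately show ?thesis using that by (simp add: abs_minus_commute[of x y])
  qed
  consider "x < y" | "y < x" | "x = y" by linarith
  then show ?thesis
  proof cases
    case 1 then show ?thesis by (rule *)
  next
    case 2 from *[OF this] show ?thesis by (simp add: abs_minus_commute add.commute)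
  next
    case 3 then show ?thesis by simp
  qed
qed

text \<open>From \<open>a\<close>, jump to \<open>M\<close> if that keeps \<open>F\<close> within
  budget, otherwise stop where the budget \<open>C\<close> is used up exactly. Hence a sequence not
  yet at \<open>M\<close> has spent exactly \<open>C\<close> on each step.\<close>

lemma greedy_thresholds:
  fixes F :: "real \<Rightarrow> real \<Rightarrow> real"
  assumes cont: "\<And>a. continuous_on UNIV (F a)" and F0: "\<And>a. F a a \<le> C" and "0 \<le> M"
  obtains t :: "nat \<Rightarrow> real" where "mono t" "t 0 = 0" "\<And>i. t i \<le> M"
    "\<And>i. F (t i) (t (Suc i)) \<le> C"
    "\<And>m. t m = M \<or> (\<forall>i<m. F (t i) (t (Suc i)) = C)"
proof -
  have "\<exists>b. a \<le> b \<and> b \<le> M \<and> F a b \<le> C \<and> (b = M \<or> F a b = C)" if "a \<le> M" for a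
  proof (cases "F a M \<le> C")
    case True
    then show ?thesis using that by blast
  next
    case False
    \<comment> \<open>Here \<open>F a a \<le> C < F a M\<close>, so the intermediate value theorem
      supplies the stopping point.\<close>
    then have "\<exists>b. a \<le> b \<and> b \<le> M \<and> F a b = C"
      using F0[of a] that cont[of a] IVT'[of "F a" a C M] by (auto intro: continuous_on_subset)
    then show ?thesis by auto
  qed
  then obtain nxt where nxt: "\<And>a. a \<le> M \<Longrightarrow> a \<le> nxt a \<and> nxt a \<le> M \<and> F a (nxt a) \<le> C
      \<and> (nxt a = M \<or> F a (nxt a) = C)" by metis
  define t where "t i = (nxt ^^ i) 0" for i
  have le: "t i \<le> M" for i
    by (induction i) (use nxt \<open>0 \<le> M\<close> in \<open>auto simp: t_def\<close>)
  have Suc: "t (Suc i) = nxt (t i)" for i by (simp add: t_def)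
  have mono: "mono t" unfolding mono_iff_le_Suc Suc using nxt le by blast
  show ?thesis
  proof (rule that[OF mono])
    show "t m = M \<or> (\<forall>i<m. F (t i) (t (Suc i)) = C)" for m
    proof (rule disjCI)
      assume "\<not> (\<forall>i<m. F (t i) (t (Suc i)) = C)"
      \<comment> \<open>A step that misses \<open>C\<close> lands on \<open>M\<close>, and the
        bounded monotone sequence stays there.\<close>
      then obtain i where "i < m" "t (Suc i) = M" using nxt[OF le] Suc by metis
      then show "t m = M" using monoD[OF mono, of "Suc i" m] le[of m] by auto
    qed
  qed (use le nxt Suc in \<open>auto simp: t_def\<close>)
qed

text \<open>A finite layer-cake decomposition: the coefficients are the increments of
  \<open>psi\<close> along \<open>S\<close>, the first being its least value. It replaces
  integration over the sweep level.\<close>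

lemma monotone_as_step_sum:
  fixes psi :: "real \<Rightarrow> real"
  assumes "finite S" "\<And>x. x \<in> S \<Longrightarrow> 0 \<le> psi x" "\<And>x y. x \<in> S \<Longrightarrow> y \<in> S \<Longrightarrow> x \<le> y \<Longrightarrow> psi x \<le> psi y"
  shows "\<exists>c. (\<forall>s\<in>S. 0 \<le> c s) \<and> (\<forall>x\<in>S. psi x = (\<Sum>s\<in>S. c s * of_bool (s \<le> x)))"
  using assms
proof (induction S rule: finite_linorder_max_induct)
  case empty
  then show ?case by simp
next
  case (insert b S)
  have "\<exists>c. (\<forall>s\<in>S. 0 \<le> c s) \<and> (\<forall>x\<in>S. psi x = (\<Sum>s\<in>S. c s * of_bool (s \<le> x)))"
    by (rule insert.IH) (use insert.prems in auto)
  then obtain c where c: "\<And>s. s \<in> S \<Longrightarrow> 0 \<le> c s" "\<And>x. x \<in> S \<Longrightarrow> psi x = (\<Sum>s\<in>S. c s * of_bool (s \<le> x))"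
    by blast
  have bS: "b \<notin> S" using insert.hyps by auto
  \<comment> \<open>At the largest old point all steps are active, so the old coefficients sum to
    \<open>psi (Max S)\<close>; monotonicity then makes the new increment nonnegative.\<close>
  have sum: "(\<Sum>s\<in>S. c s) \<le> psi b"
  proof (cases "S = {}")
    case True
    then show ?thesis using insert.prems(1)[of b] by simp
  next
    case False
    have "psi (Max S) = (\<Sum>s\<in>S. c s * of_bool (s \<le> Max S))"
      by (rule c(2)[OF Max_in[OF insert.hyps(1) False]])
    also have "\<dots> = (\<Sum>s\<in>S. c s)" by (rule sum.cong) (use insert.hyps(1) in auto)
    finally show ?thesis using insert.prems(2)[of "Max S" b] insert.hyps Max_in[OF insert.hyps(1) False]
      by auto
  qed
  define c' where "c' = c(b := psi b - (\<Sum>s\<in>S. c s))"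
  have c': "(\<Sum>s\<in>S. c' s * of_bool (s \<le> x)) = (\<Sum>s\<in>S. c s * of_bool (s \<le> x))" for x
    by (rule sum.cong) (use bS in \<open>auto simp: c'_def\<close>)
  show ?case
  proof (rule exI[of _ c'], intro conjI ballI)
    fix s assume "s \<in> insert b S"
    then show "0 \<le> c' s" using c(1) sum by (auto simp: c'_def)
  next
    fix x assume x: "x \<in> insert b S"
    have ins: "(\<Sum>s\<in>insert b S. c' s * of_bool (s \<le> x))
        = c' b * of_bool (b \<le> x) + (\<Sum>s\<in>S. c s * of_bool (s \<le> x))"
      by (simp only: sum.insert[OF insert.hyps(1) bS] c')
    show "psi x = (\<Sum>s\<in>insert b S. c' s * of_bool (s \<le> x))"
    proof (cases "x = b")
      case True
      have "(\<Sum>s\<in>S. c s * of_bool (s \<le> b)) = (\<Sum>s\<in>S. c s)"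
        by (rule sum.cong) (use insert.hyps(2) in \<open>auto simp: less_imp_le\<close>)
      then show ?thesis unfolding ins using True by (simp add: c'_def)
    next
      case False
      then have "x \<in> S" "x < b" using x insert.hyps by auto
      then show ?thesis unfolding ins using c(2)[of x] by simp
    qed
  qed
qed

section \<open>Sweep cuts\<close>

definition edge_sum :: "nat \<Rightarrow> (nat \<Rightarrow> nat \<Rightarrow> real) \<Rightarrow> (nat \<Rightarrow> nat \<Rightarrow> real) \<Rightarrow> real" where
  "edge_sum n w F = (\<Sum>(u,v)\<in>{(u,v). u < n \<and> v < n \<and> u < v}. w u v * F u v)"

lemma finite_edges: "finite {(u,v). u < n \<and> v < n \<and> u < (v::nat)}"
  by (rule finite_subset[of _ "{..<n} \<times> {..<n}"]) auto

lemma edge_sum_cong: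
  assumes "\<And>u v. u < n \<Longrightarrow> v < n \<Longrightarrow> F u v = F' u v"
  shows "edge_sum n w F = edge_sum n w F'"
  unfolding edge_sum_def by (rule sum.cong) (use assms in auto)

lemma edge_sum_mono:
  assumes "wgraph n w" "\<And>u v. u < n \<Longrightarrow> v < n \<Longrightarrow> F u v \<le> F' u v"
  shows "edge_sum n w F \<le> edge_sum n w F'"
  unfolding edge_sum_def
  by (rule sum_mono) (use assms in \<open>auto simp: wgraph_def intro!: mult_left_mono\<close>)

lemma edge_sum_nonneg:
  assumes "wgraph n w" "\<And>u v. u < n \<Longrightarrow> v < n \<Longrightarrow> 0 \<le> F u v"
  shows "0 \<le> edge_sum n w F"
  unfolding edge_sum_def by (rule sum_nonneg) (use assms in \<open>auto simp: wgraph_def\<close>)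

lemma edge_sum_add: "edge_sum n w (\<lambda>u v. F u v + F' u v) = edge_sum n w F + edge_sum n w F'"
  unfolding edge_sum_def sum.distrib[symmetric] by (rule sum.cong) (auto simp: algebra_simps)

lemma edge_sum_scale: "edge_sum n w (\<lambda>u v. c * F u v) = c * edge_sum n w F"
  unfolding edge_sum_def sum_distrib_left by (rule sum.cong) auto

lemma edge_sum_sum: "edge_sum n w (\<lambda>u v. \<Sum>s\<in>S. F s u v) = (\<Sum>s\<in>S. edge_sum n w (F s))"
  unfolding edge_sum_def by (subst sum.swap) (auto simp: sum_distrib_left intro!: sum.cong)

lemma edge_sum_alt: "edge_sum n w F = (\<Sum>u<n. \<Sum>v<n. if u < v then w u v * F u v else 0)"
proof -
  have "{(u,v). u < n \<and> v < n \<and> u < v} = {p \<in> {..<n} \<times> {..<n}. fst p < snd p}" by auto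
  then have "edge_sum n w F = (\<Sum>p\<in>{p \<in> {..<n} \<times> {..<n}. fst p < snd p}. w (fst p) (snd p) * F (fst p) (snd p))"
    by (simp add: edge_sum_def case_prod_beta)
  also have "\<dots> = (\<Sum>p\<in>{..<n} \<times> {..<n}. if fst p < snd p then w (fst p) (snd p) * F (fst p) (snd p) else 0)"
    by (rule sum.inter_filter) simp
  finally show ?thesis by (simp add: sum.cartesian_product case_prod_beta)
qed

lemma double_sum_edge_sum:
  assumes "wgraph n w"
  shows "(\<Sum>u<n. \<Sum>v<n. w u v * F u v) = edge_sum n w (\<lambda>u v. F u v + F v u)"
proof -
  have sym: "w u v = w v u" and z: "w u u = 0" for u v using assms by (auto simp: wgraph_def)
  have "(\<Sum>u<n. \<Sum>v<n. w u v * F u v) =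
    (\<Sum>u<n. \<Sum>v<n. (if u < v then w u v * F u v else 0) + (if v < u then w u v * F u v else 0))"
    by (intro sum.cong refl) (auto simp: z not_less_iff_gr_or_eq)
  also have "\<dots> = edge_sum n w F + (\<Sum>u<n. \<Sum>v<n. if v < u then w u v * F u v else 0)"
    by (simp add: sum.distrib edge_sum_alt)
  also have "(\<Sum>u<n. \<Sum>v<n. if v < u then w u v * F u v else 0) = edge_sum n w (\<lambda>u v. F v u)"
    unfolding edge_sum_alt by (subst sum.swap) (intro sum.cong refl, simp add: sym)
  finally show ?thesis by (simp add: edge_sum_add)
qed

lemma deg_sum_edge_sum:
  assumes "wgraph n w"
  shows "(\<Sum>v<n. deg n w v * a v) = edge_sum n w (\<lambda>u v. a u + a v)"
proof -
  have "(\<Sum>v<n. deg n w v * a v) = (\<Sum>u<n. \<Sum>v<n. w u v * a v)"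
    unfolding deg_def sum_distrib_right by (rule sum.swap)
  also have "\<dots> = edge_sum n w (\<lambda>u v. a v + a u)" by (rule double_sum_edge_sum[OF assms])
  finally show ?thesis by (simp add: add.commute)
qed

lemma wE_edge_sum:
  assumes "S \<subseteq> {0..<n}"
  shows "wE w S = edge_sum n w (\<lambda>u v. of_bool (u \<in> S \<and> v \<in> S))"
proof -
  have "edge_sum n w (\<lambda>u v. of_bool (u \<in> S \<and> v \<in> S))
     = (\<Sum>(u,v)\<in>{(u,v). u \<in> S \<and> v \<in> S \<and> u < v}. w u v * of_bool (u \<in> S \<and> v \<in> S))"
    unfolding edge_sum_def
    by (rule sum.mono_neutral_right[OF finite_edges]) (use assms in auto)
  also have "\<dots> = wE w S" unfolding wE_def by (rule sum.cong) auto
  finally show ?thesis by simp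
qed

lemma wCut_edge_sum:
  assumes "wgraph n w" "S \<subseteq> {0..<n}"
  shows "wCut w S ({0..<n} - S) = edge_sum n w (\<lambda>u v. of_bool ((u \<in> S) \<noteq> (v \<in> S)))"
proof -
  have "wCut w S ({0..<n} - S) = (\<Sum>u\<in>S. \<Sum>v<n. w u v * of_bool (v \<notin> S))"
    unfolding wCut_def by (intro sum.cong refl sum.mono_neutral_cong_left) auto
  also have "\<dots> = (\<Sum>u<n. \<Sum>v<n. w u v * of_bool (u \<in> S \<and> v \<notin> S))"
    by (rule sum.mono_neutral_cong_left) (use assms in auto)
  also have "\<dots> = edge_sum n w (\<lambda>u v. of_bool (u \<in> S \<and> v \<notin> S) + of_bool (v \<in> S \<and> u \<notin> S))"
    by (rule double_sum_edge_sum[OF assms(1)])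
  also have "\<dots> = edge_sum n w (\<lambda>u v. of_bool ((u \<in> S) \<noteq> (v \<in> S)))"
    by (rule edge_sum_cong) auto
  finally show ?thesis .
qed

section \<open>Bipartiteness ratios of threshold cuts and their averages\<close>

lemma deg_nonneg: "wgraph n w \<Longrightarrow> 0 \<le> deg n w v"
  unfolding deg_def wgraph_def by (simp add: sum_nonneg)

lemma bip_ratio_nonneg:
  assumes "wgraph n w"
  shows "0 \<le> bip_ratio n w L R"
proof -
  have w: "0 \<le> w u v" for u v using assms by (simp add: wgraph_def)
  show ?thesis unfolding bip_ratio_def wE_def wCut_def vol_def
    by (intro divide_nonneg_nonneg add_nonneg_nonneg mult_nonneg_nonneg sum_nonneg)
      (auto simp: w deg_nonneg[OF assms])
qed

lemma bip_fun_nonneg: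
  assumes "wgraph n w" "\<exists>v<n. f v \<noteq> 0"
  shows "0 \<le> bip_fun n w f"
proof -
  obtain v where v: "v < n" "f v \<noteq> 0" using assms(2) by blast
  \<comment> \<open>The level \<open>\<bar>f v\<bar>\<close> makes the index set of the infimum
    nonempty, as a lower bound for \<open>Inf\<close> demands.\<close>
  then have "v \<in> Lset n f \<bar>f v\<bar> \<union> Rset n f \<bar>f v\<bar>" by (auto simp: Lset_def Rset_def)
  then show ?thesis unfolding bip_fun_def
    by (intro cInf_greatest) (use v bip_ratio_nonneg[OF assms(1)] in \<open>fastforce+\<close>)
qed

lemma bip_fun_le_ratio:
  assumes "wgraph n w" "0 < s" "Lset n f s \<union> Rset n f s \<noteq> {}"
  shows "bip_fun n w f \<le> bip_ratio n w (Lset n f s) (Rset n f s)"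
  unfolding bip_fun_def
  by (rule cInf_lower) (use assms bip_ratio_nonneg[OF assms(1)] in \<open>auto intro!: bdd_belowI[of _ 0]\<close>)

lemma bip_graph_le_bip_fun:
  assumes "wgraph n w" "\<exists>v<n. f v \<noteq> 0"
  shows "bip_graph n w \<le> bip_fun n w f"
proof -
  obtain v where v: "v < n" "f v \<noteq> 0" using assms(2) by blast
  then have "v \<in> Lset n f \<bar>f v\<bar> \<union> Rset n f \<bar>f v\<bar>" by (auto simp: Lset_def Rset_def)
  then have ne: "{bip_ratio n w (Lset n f t) (Rset n f t) | t. t > 0 \<and> Lset n f t \<union> Rset n f t \<noteq> {}} \<noteq> {}"
    using v by fastforce
  show ?thesis unfolding bip_graph_def bip_fun_def
  proof (rule cInf_superset_mono[OF ne])
    show "bdd_below {bip_ratio n w L R | L R. L \<subseteq> {0..<n} \<and> R \<subseteq> {0..<n} \<and> L \<inter> R = {} \<and> L \<union> R \<noteq> {}}"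
      using bip_ratio_nonneg[OF assms(1)] by (auto intro!: bdd_belowI[of _ 0])
    have "Lset n f t \<subseteq> {0..<n}" "Rset n f t \<subseteq> {0..<n}" for t by (auto simp: Lset_def Rset_def)
    moreover have "t > 0 \<Longrightarrow> Lset n f t \<inter> Rset n f t = {}" for t by (auto simp: Lset_def Rset_def)
    ultimately show "{bip_ratio n w (Lset n f t) (Rset n f t) | t. t > 0 \<and> Lset n f t \<union> Rset n f t \<noteq> {}}
      \<subseteq> {bip_ratio n w L R | L R. L \<subseteq> {0..<n} \<and> R \<subseteq> {0..<n} \<and> L \<inter> R = {} \<and> L \<union> R \<noteq> {}}"
      by blast
  qed
qed

text \<open>The share of an edge with end values \<open>x\<close>, \<open>y\<close> in the cut
  numerator, averaged over levels with cumulative weight \<open>psi\<close>. Levels between the two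
  absolute values cut the edge once; at lower levels it counts twice if both ends lie on one side,
  and not at all if it joins the two sides.\<close>

definition cut_kernel :: "(real \<Rightarrow> real) \<Rightarrow> real \<Rightarrow> real \<Rightarrow> real" where
  "cut_kernel psi x y = psi (max \<bar>x\<bar> \<bar>y\<bar>) + (if 0 \<le> x * y then 1 else - 1) * psi (min \<bar>x\<bar> \<bar>y\<bar>)"

lemma threshold_cut_edge_sum:
  assumes G: "wgraph n w" and s: "0 < s"
  shows "2 * wE w (Lset n f s) + 2 * wE w (Rset n f s)
      + wCut w (Lset n f s \<union> Rset n f s) ({0..<n} - (Lset n f s \<union> Rset n f s))
    = edge_sum n w (\<lambda>u v. cut_kernel (\<lambda>x. of_bool (s \<le> x)) (f u) (f v))"
proof -
  let ?L = "Lset n f s" let ?R = "Rset n f s"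
  have sub: "?L \<subseteq> {0..<n}" "?R \<subseteq> {0..<n}" by (auto simp: Lset_def Rset_def)
  then have sub': "?L \<union> ?R \<subseteq> {0..<n}" by simp
  have ker: "2 * of_bool (u \<in> ?L \<and> v \<in> ?L) + 2 * of_bool (u \<in> ?R \<and> v \<in> ?R)
      + of_bool ((u \<in> ?L \<union> ?R) \<noteq> (v \<in> ?L \<union> ?R)) = cut_kernel (\<lambda>x. of_bool (s \<le> x)) (f u) (f v)"
    if "u < n" "v < n" for u v
  proof -
    have mem: "x \<in> ?L \<longleftrightarrow> f x \<le> - s" "x \<in> ?R \<longleftrightarrow> s \<le> f x" if "x < n" for x
      using that by (auto simp: Lset_def Rset_def)
    consider "0 < f u" "0 < f v" | "f u < 0" "f v < 0" | "f u < 0" "0 < f v" | "0 < f u" "f v < 0"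
      | "f u = 0" | "f v = 0" by linarith
    then show ?thesis
      using s
      by cases (auto simp: mem that cut_kernel_def max_def min_def not_le mult_less_0_iff zero_le_mult_iff)
  qed
  show ?thesis
    unfolding wE_edge_sum[OF sub(1)] wE_edge_sum[OF sub(2)] wCut_edge_sum[OF G sub']
      edge_sum_scale[symmetric] edge_sum_add[symmetric]
    by (rule edge_sum_cong) (rule ker)
qed

text \<open>The ratio at one level with its denominator cleared, so that levels can be added. The
  vertex \<open>v0\<close> has degree at least 1 and keeps the volume positive.\<close>

lemma bip_fun_le_threshold:
  assumes G: "wgraph n w" and degpos: "\<And>v. v < n \<Longrightarrow> deg n w v \<ge> 1"
    and s: "0 < s" "v0 < n" "s \<le> \<bar>f v0\<bar>"
  shows "bip_fun n w f * (\<Sum>v<n. deg n w v * of_bool (s \<le> \<bar>f v\<bar>))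
    \<le> edge_sum n w (\<lambda>u v. cut_kernel (\<lambda>x. of_bool (s \<le> x)) (f u) (f v))"
proof -
  let ?S = "Lset n f s \<union> Rset n f s"
  have v0: "v0 \<in> ?S" using s by (auto simp: Lset_def Rset_def)
  have "vol n w ?S = (\<Sum>v<n. deg n w v * of_bool (s \<le> \<bar>f v\<bar>))"
    unfolding vol_def by (rule sum.mono_neutral_cong_left) (auto simp: Lset_def Rset_def)
  moreover have "vol n w ?S > 0" unfolding vol_def
  proof (rule sum_pos2[OF _ v0])
    show "finite ?S" by (auto simp: Lset_def Rset_def)
    show "0 < deg n w v0" using degpos[OF s(2)] by simp
  qed (rule deg_nonneg[OF G])
  moreover have "bip_fun n w f \<le> bip_ratio n w (Lset n f s) (Rset n f s)"
    by (rule bip_fun_le_ratio) (use G s v0 in auto)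
  ultimately show ?thesis
    unfolding bip_ratio_def threshold_cut_edge_sum[OF G s(1)] by (simp add: pos_le_divide_eq)
qed

text \<open>A minimum of ratios is at most the ratio of averages: decompose \<open>psi\<close> into
  steps and add the one-level inequalities with the nonnegative coefficients.\<close>

lemma bip_fun_le_cut_kernel:
  assumes G: "wgraph n w" and degpos: "\<And>v. v < n \<Longrightarrow> deg n w v \<ge> 1"
    and mono: "\<And>x y. 0 \<le> x \<Longrightarrow> x \<le> y \<Longrightarrow> psi x \<le> psi y" and psi0: "psi 0 = 0"
  shows "bip_fun n w f * (\<Sum>v<n. deg n w v * psi \<bar>f v\<bar>)
    \<le> edge_sum n w (\<lambda>u v. cut_kernel psi (f u) (f v))"
proof -
  \<comment> \<open>Only levels attained by nonzero values occur. Level 0 is not an admissible cut,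
    and \<open>psi 0 = 0\<close> makes zero values contribute nothing.\<close>
  define S where "S = (\<lambda>v. \<bar>f v\<bar>) ` {v. v < n \<and> f v \<noteq> 0}"
  have S: "finite S" "\<And>s. s \<in> S \<Longrightarrow> 0 < s" by (auto simp: S_def)
  have "0 \<le> psi x" if "x \<in> S" for x using mono[of 0 x] psi0 S(2)[OF that] by simp
  moreover have "psi x \<le> psi y" if "x \<in> S" "x \<le> y" for x y
    using mono S(2)[OF that(1)] that by (simp add: less_imp_le)
  ultimately obtain c where c: "\<And>s. s \<in> S \<Longrightarrow> 0 \<le> c s"
      "\<And>x. x \<in> S \<Longrightarrow> psi x = (\<Sum>s\<in>S. c s * of_bool (s \<le> x))"
    using monotone_as_step_sum[OF S(1), of psi] by blast
  have psi: "psi \<bar>f v\<bar> = (\<Sum>s\<in>S. c s * of_bool (s \<le> \<bar>f v\<bar>))" if "v < n" for v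
  proof (cases "f v = 0")
    case True
    have "(\<Sum>s\<in>S. c s * of_bool (s \<le> 0)) = 0" by (rule sum.neutral) (use S(2) in force)
    then show ?thesis using True psi0 by simp
  next
    case False
    then show ?thesis using c(2) that by (auto simp: S_def)
  qed
  have ker: "cut_kernel psi (f u) (f v)
      = (\<Sum>s\<in>S. c s * cut_kernel (\<lambda>x. of_bool (s \<le> x)) (f u) (f v))" if "u < n" "v < n" for u v
  proof -
    \<comment> \<open>The maximum and the minimum are themselves values
      \<open>\<bar>f u\<bar>\<close> or \<open>\<bar>f v\<bar>\<close>, where the decomposition is
      available.\<close>
    have "psi (max \<bar>f u\<bar> \<bar>f v\<bar>) = (\<Sum>s\<in>S. c s * of_bool (s \<le> max \<bar>f u\<bar> \<bar>f v\<bar>))"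
      using psi that unfolding max_def by presburger
    moreover have "psi (min \<bar>f u\<bar> \<bar>f v\<bar>) = (\<Sum>s\<in>S. c s * of_bool (s \<le> min \<bar>f u\<bar> \<bar>f v\<bar>))"
      using psi that unfolding min_def by presburger
    ultimately show ?thesis
      unfolding cut_kernel_def
      by (simp only: sum_distrib_left sum.distrib[symmetric] distrib_left mult.left_commute)
  qed
  have "bip_fun n w f * (\<Sum>v<n. deg n w v * psi \<bar>f v\<bar>)
      = bip_fun n w f * (\<Sum>v<n. deg n w v * (\<Sum>s\<in>S. c s * of_bool (s \<le> \<bar>f v\<bar>)))"
    using psi by simp
  also have "\<dots> = (\<Sum>s\<in>S. c s * (bip_fun n w f * (\<Sum>v<n. deg n w v * of_bool (s \<le> \<bar>f v\<bar>))))"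
    unfolding sum_distrib_left by (subst sum.swap) (simp only: mult_ac)
  also have "\<dots> \<le> (\<Sum>s\<in>S. c s * edge_sum n w (\<lambda>u v. cut_kernel (\<lambda>x. of_bool (s \<le> x)) (f u) (f v)))"
  proof (intro sum_mono mult_left_mono)
    fix s assume "s \<in> S"
    then obtain v where "v < n" "s = \<bar>f v\<bar>" "0 < s" by (auto simp: S_def)
    then show "bip_fun n w f * (\<Sum>v<n. deg n w v * of_bool (s \<le> \<bar>f v\<bar>))
        \<le> edge_sum n w (\<lambda>u v. cut_kernel (\<lambda>x. of_bool (s \<le> x)) (f u) (f v))"
      by (intro bip_fun_le_threshold[OF G degpos]) auto
  qed (rule c)
  also have "\<dots> = edge_sum n w (\<lambda>u v. cut_kernel psi (f u) (f v))"
    unfolding edge_sum_scale[symmetric] edge_sum_sum[symmetric]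
    by (rule edge_sum_cong) (simp only: ker)
  finally show ?thesis .
qed

text \<open>Reflecting one end value absorbs the sign cases into a difference at \<open>x\<close>
  and \<open>- y\<close>, whose distance is \<open>\<bar>x + y\<bar>\<close>, the quantity squared
  in the energy.\<close>

lemma cut_kernel_odd_part:
  assumes mono: "\<And>x y. x \<le> y \<Longrightarrow> g x \<le> g y" and g0: "\<And>x. x \<le> 0 \<Longrightarrow> g x = 0"
  shows "cut_kernel g x y = \<bar>odd_part g x - odd_part g (- y)\<bar>"
proof -
  have nonneg: "0 \<le> g z" for z using mono[of 0 z] g0[of 0] g0[of z] by (cases "0 \<le> z") auto
  consider "0 \<le> x" "0 \<le> y" | "x \<le> 0" "y \<le> 0" | "x < 0" "0 < y" | "0 < x" "y < 0" by linarith
  then show ?thesis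
  proof cases
    case 1
    then show ?thesis using nonneg[of x] nonneg[of y]
      by (auto simp: cut_kernel_def odd_part_def g0 max_def min_def)
  next
    case 2
    then show ?thesis using nonneg[of "- x"] nonneg[of "- y"]
      by (auto simp: cut_kernel_def odd_part_def g0 max_def min_def mult_nonpos_nonpos)
  next
    case 3
    then have "x * y < 0" by (simp add: mult_neg_pos)
    then show ?thesis using 3 mono[of "- x" y] mono[of y "- x"]
      by (auto simp: cut_kernel_def odd_part_def g0 max_def min_def)
  next
    case 4
    then have "x * y < 0" by (simp add: mult_pos_neg)
    then show ?thesis using 4 mono[of x "- y"] mono[of "- y" x]
      by (auto simp: cut_kernel_def odd_part_def g0 max_def min_def)
  qed
qed

section \<open>The improved bound\<close>

definition signless_entry :: "nat \<Rightarrow> (nat \<Rightarrow> nat \<Rightarrow> real) \<Rightarrow> nat \<Rightarrow> nat \<Rightarrow> real" where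
  "signless_entry n w i j = (if i = j then 1 else 0) + w i j / (sqrt (deg n w i) * sqrt (deg n w j))"

lemma signless_norm_mat_eq: "signless_norm_mat n w = mat n n (\<lambda>(i,j). signless_entry n w i j)"
  by (simp add: signless_norm_mat_def signless_entry_def)

lemma signless_entry_sym: "wgraph n w \<Longrightarrow> signless_entry n w i j = signless_entry n w j i"
  by (simp add: signless_entry_def wgraph_def mult.commute)

lemma ip_weighted:
  assumes "wgraph n w"
  shows "ip n (\<lambda>v. sqrt (deg n w v) * \<phi> v) (\<lambda>v. sqrt (deg n w v) * \<phi> v) = (\<Sum>v<n. deg n w v * (\<phi> v)\<^sup>2)"
  unfolding ip_def
proof (rule sum.cong)
  fix v
  have "sqrt (deg n w v) * sqrt (deg n w v) = deg n w v" using deg_nonneg[OF assms] by simp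
  then show "sqrt (deg n w v) * \<phi> v * (sqrt (deg n w v) * \<phi> v) = deg n w v * (\<phi> v)\<^sup>2"
    by (metis mult.assoc mult.left_commute power2_eq_square)
qed simp

text \<open>Scaling by the square roots of the degrees cancels the normalization: the identity part
  gives the two squares on each edge and the adjacency part the cross term.\<close>

lemma signless_quadratic_form:
  assumes G: "wgraph n w" and degpos: "\<And>v. v < n \<Longrightarrow> deg n w v \<ge> 1"
  shows "ip n (\<lambda>v. sqrt (deg n w v) * \<phi> v)
      (\<lambda>i. \<Sum>j<n. signless_entry n w i j * (sqrt (deg n w j) * \<phi> j))
    = edge_sum n w (\<lambda>u v. (\<phi> u + \<phi> v)\<^sup>2)"
proof -
  let ?x = "\<lambda>v. sqrt (deg n w v) * \<phi> v"
  have row: "(\<Sum>j<n. signless_entry n w i j * ?x j) = ?x i + (\<Sum>j<n. w i j * \<phi> j) / sqrt (deg n w i)"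
    if i: "i < n" for i
  proof -
    have "(\<Sum>j<n. signless_entry n w i j * ?x j)
        = (\<Sum>j<n. (if i = j then ?x j else 0) + w i j * \<phi> j / sqrt (deg n w i))"
    proof (rule sum.cong)
      fix j assume "j \<in> {..<n}"
      then have "sqrt (deg n w j) \<noteq> 0" using degpos[of j] by auto
      then show "signless_entry n w i j * ?x j = (if i = j then ?x j else 0) + w i j * \<phi> j / sqrt (deg n w i)"
        by (simp add: signless_entry_def distrib_right)
    qed simp
    then show ?thesis using i by (simp add: sum.distrib sum_divide_distrib)
  qed
  have "ip n ?x (\<lambda>i. \<Sum>j<n. signless_entry n w i j * ?x j)
      = ip n ?x (\<lambda>i. ?x i + (\<Sum>j<n. w i j * \<phi> j) / sqrt (deg n w i))"
    by (rule ip_cong) (use row in auto)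
  also have "\<dots> = (\<Sum>v<n. deg n w v * (\<phi> v)\<^sup>2) + ip n ?x (\<lambda>i. (\<Sum>j<n. w i j * \<phi> j) / sqrt (deg n w i))"
    unfolding ip_add_right ip_weighted[OF G] ..
  also have "ip n ?x (\<lambda>i. (\<Sum>j<n. w i j * \<phi> j) / sqrt (deg n w i)) = (\<Sum>i<n. \<Sum>j<n. w i j * (\<phi> i * \<phi> j))"
    unfolding ip_def
  proof (rule sum.cong)
    fix i assume "i \<in> {..<n}"
    then have "sqrt (deg n w i) \<noteq> 0" using degpos[of i] by auto
    then have "?x i * ((\<Sum>j<n. w i j * \<phi> j) / sqrt (deg n w i)) = \<phi> i * (\<Sum>j<n. w i j * \<phi> j)"
      by simp
    then show "?x i * ((\<Sum>j<n. w i j * \<phi> j) / sqrt (deg n w i)) = (\<Sum>j<n. w i j * (\<phi> i * \<phi> j))"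
      by (simp only: sum_distrib_left mult.left_commute)
  qed simp
  also have "(\<Sum>v<n. deg n w v * (\<phi> v)\<^sup>2) + \<dots> = edge_sum n w (\<lambda>u v. (\<phi> u + \<phi> v)\<^sup>2)"
    unfolding deg_sum_edge_sum[OF G] double_sum_edge_sum[OF G] edge_sum_add[symmetric]
    by (rule edge_sum_cong) (simp add: power2_sum)
  finally show ?thesis .
qed

section \<open>Eigenvalue bounds from disjointly supported functions\<close>

lemma sum_eq_single:
  fixes A :: "nat \<Rightarrow> real"
  assumes "l < k" "\<And>i. i < k \<Longrightarrow> i \<noteq> l \<Longrightarrow> A i = 0"
  shows "(\<Sum>i<k. A i) = A l"
proof -
  have "(\<Sum>i<k. A i) = (\<Sum>i\<in>{l}. A i)"
    by (rule sum.mono_neutral_right) (use assms in auto)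
  then show ?thesis by simp
qed

text \<open>Each of the two families has at most one nonzero member, so at most two indices contribute.\<close>

lemma two_orthogonal_families_sq_le:
  fixes A B :: "nat \<Rightarrow> real"
  assumes "0 < k" "\<And>i j. i < k \<Longrightarrow> j < k \<Longrightarrow> i \<noteq> j \<Longrightarrow> A i * A j = 0"
    "\<And>i j. i < k \<Longrightarrow> j < k \<Longrightarrow> i \<noteq> j \<Longrightarrow> B i * B j = 0"
  shows "((\<Sum>i<k. A i) + (\<Sum>i<k. B i))\<^sup>2 \<le> 2 * (\<Sum>i<k. (A i + B i)\<^sup>2)"
proof -
  have single: "\<exists>l<k. \<forall>i<k. i \<noteq> l \<longrightarrow> A i = 0"
    if "\<And>i j. i < k \<Longrightarrow> j < k \<Longrightarrow> i \<noteq> j \<Longrightarrow> A i * A j = 0" for A :: "nat \<Rightarrow> real"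
  proof (cases "\<exists>l<k. A l \<noteq> 0")
    case True
    then show ?thesis using that by (metis mult_eq_0_iff)
  next
    case False
    then show ?thesis using \<open>0 < k\<close> by blast
  qed
  obtain l where l: "l < k" "\<And>i. i < k \<Longrightarrow> i \<noteq> l \<Longrightarrow> A i = 0" using single[of A] assms(2) by blast
  obtain r where r: "r < k" "\<And>i. i < k \<Longrightarrow> i \<noteq> r \<Longrightarrow> B i = 0" using single[of B] assms(3) by blast
  have sums: "(\<Sum>i<k. A i) = A l" "(\<Sum>i<k. B i) = B r"
    by (rule sum_eq_single[OF l(1)], rule l(2), assumption+)
       (rule sum_eq_single[OF r(1)], rule r(2), assumption+)
  show ?thesis
  proof (cases "l = r")
    case True
    have "(A l + B l)\<^sup>2 \<le> (\<Sum>i<k. (A i + B i)\<^sup>2)"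
      by (rule member_le_sum) (use l in auto)
    moreover have "0 \<le> (A l + B l)\<^sup>2" by simp
    ultimately show ?thesis unfolding sums True[symmetric] by linarith
  next
    case False
    have "(\<Sum>i\<in>{l,r}. (A i + B i)\<^sup>2) \<le> (\<Sum>i<k. (A i + B i)\<^sup>2)"
      by (rule sum_mono2) (use l r in auto)
    then have "(A l)\<^sup>2 + (B r)\<^sup>2 \<le> (\<Sum>i<k. (A i + B i)\<^sup>2)"
      using False l(2)[OF r(1)] r(2)[OF l(1)] by simp
    moreover have "(A l + B r)\<^sup>2 \<le> 2 * ((A l)\<^sup>2 + (B r)\<^sup>2)"
      using zero_le_power2[of "A l - B r"] by (simp add: power2_sum power2_diff)
    moreover have "y \<le> z \<Longrightarrow> x \<le> 2 * y \<Longrightarrow> x \<le> 2 * z" for x y z :: real by linarith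
    ultimately show ?thesis unfolding sums by blast
  qed
qed

text \<open>Courant--Fischer on the span of the \<open>g i\<close>: disjoint supports make squared
  norms add exactly, whereas energies add only up to a factor 2, since an edge may join two
  supports.\<close>

lemma disjoint_functions_eigenvalue_le:
  assumes G: "wgraph n w" and degpos: "\<And>v. v < n \<Longrightarrow> deg n w v \<ge> 1"
    and eig: "sorted_eigenvalues (signless_norm_mat n w) alphas"
    and k: "1 \<le> k" "k \<le> n"
    and disj: "\<And>i j v. i < k \<Longrightarrow> j < k \<Longrightarrow> i \<noteq> j \<Longrightarrow> v < n \<Longrightarrow> g i v * g j v = 0"
    and pos: "\<And>i. i < k \<Longrightarrow> (\<Sum>v<n. deg n w v * (g i v)\<^sup>2) > 0"
    and ray: "\<And>i. i < k \<Longrightarrow> edge_sum n w (\<lambda>u v. (g i u + g i v)\<^sup>2) \<le> lam * (\<Sum>v<n. deg n w v * (g i v)\<^sup>2)"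
  shows "alphas ! (k - 1) \<le> 2 * lam"
proof (rule courant_fischer_upper[of n "signless_entry n w" _ _ "\<lambda>l v. sqrt (deg n w v) * g l v"])
  show "signless_entry n w i j = signless_entry n w j i" for i j by (rule signless_entry_sym[OF G])
  show "sorted_eigenvalues (mat n n (\<lambda>(i, j). signless_entry n w i j)) alphas"
    using eig by (simp add: signless_norm_mat_eq)
  have sq: "(\<Sum>l<k. c l * g l v)\<^sup>2 = (\<Sum>l<k. (c l)\<^sup>2 * (g l v)\<^sup>2)" if "v < n" for c v
    unfolding power_mult_distrib[symmetric]
    by (rule sum_sq_orthogonal) (use disj that in auto)
  have fac: "(\<Sum>l<k. c l * (sqrt (deg n w v) * g l v)) = sqrt (deg n w v) * (\<Sum>l<k. c l * g l v)" for c v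
    by (simp add: sum_distrib_left mult.left_commute)
  show "\<exists>i<n. (\<Sum>l<k. c l * (sqrt (deg n w i) * g l i)) \<noteq> 0" if "\<exists>l<k. c l \<noteq> 0" for c
  proof -
    obtain l where l: "l < k" "c l \<noteq> 0" using \<open>\<exists>l<k. c l \<noteq> 0\<close> by blast
    have "\<exists>v<n. g l v \<noteq> 0"
    proof (rule ccontr)
      assume "\<not> ?thesis"
      then have "(\<Sum>v<n. deg n w v * (g l v)\<^sup>2) = 0" by (intro sum.neutral) auto
      then show False using pos[OF l(1)] by simp
    qed
    then obtain v where v: "v < n" "g l v \<noteq> 0" by blast
    have "(\<Sum>i<k. c i * g i v)\<^sup>2 > 0"
      unfolding sq[OF v(1)] by (rule sum_pos2[of _ l]) (use l v in auto)
    then have "(\<Sum>i<k. c i * g i v) \<noteq> 0" by auto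
    then show ?thesis unfolding fac using v(1) degpos[OF v(1)] by auto
  qed
  fix c x assume "x = (\<lambda>i. \<Sum>l<k. c l * (sqrt (deg n w i) * g l i))"
  then have x: "x = (\<lambda>v. sqrt (deg n w v) * (\<Sum>l<k. c l * g l v))" by (simp only: fac)
  have "edge_sum n w (\<lambda>u v. ((\<Sum>l<k. c l * g l u) + (\<Sum>l<k. c l * g l v))\<^sup>2)
      \<le> edge_sum n w (\<lambda>u v. 2 * (\<Sum>l<k. (c l * g l u + c l * g l v)\<^sup>2))"
    by (intro edge_sum_mono[OF G] two_orthogonal_families_sq_le) (use k disj in auto)
  also have "\<dots> = 2 * (\<Sum>l<k. (c l)\<^sup>2 * edge_sum n w (\<lambda>u v. (g l u + g l v)\<^sup>2))"
    by (simp only: edge_sum_scale edge_sum_sum distrib_left[symmetric] power_mult_distrib)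
  also have "\<dots> \<le> 2 * (\<Sum>l<k. (c l)\<^sup>2 * (lam * (\<Sum>v<n. deg n w v * (g l v)\<^sup>2)))"
    by (intro mult_left_mono sum_mono) (use ray in auto)
  also have "\<dots> = 2 * lam * (\<Sum>v<n. deg n w v * (\<Sum>l<k. c l * g l v)\<^sup>2)"
  proof -
    have "(\<Sum>v<n. deg n w v * (\<Sum>l<k. c l * g l v)\<^sup>2) = (\<Sum>v<n. deg n w v * (\<Sum>l<k. (c l)\<^sup>2 * (g l v)\<^sup>2))"
      by (rule sum.cong) (auto simp: sq)
    also have "\<dots> = (\<Sum>l<k. (c l)\<^sup>2 * (\<Sum>v<n. deg n w v * (g l v)\<^sup>2))"
      unfolding sum_distrib_left by (subst sum.swap) (simp only: mult_ac)
    finally show ?thesis by (simp add: sum_distrib_left mult_ac)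
  qed
  finally show "ip n x (\<lambda>i. \<Sum>j<n. signless_entry n w i j * x j) \<le> 2 * lam * ip n x x"
    unfolding x ip_weighted[OF G] by (subst signless_quadratic_form[OF G degpos])
qed (use k in auto)

text \<open>Point indicators are disjointly supported and have Rayleigh quotient 1, so the factor 2
  for disjoint families is the bound.\<close>

lemma eigenvalue_le_2:
  assumes G: "wgraph n w" and degpos: "\<And>v. v < n \<Longrightarrow> deg n w v \<ge> 1"
    and eig: "sorted_eigenvalues (signless_norm_mat n w) alphas"
    and k: "1 \<le> k" "k \<le> n"
  shows "alphas ! (k - 1) \<le> 2"
proof -
  have "alphas ! (k - 1) \<le> 2 * 1"
  proof (rule disjoint_functions_eigenvalue_le[OF G degpos eig k, where g = "\<lambda>i v. of_bool (v = i)"])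
    fix i assume i: "i < k"
    have N: "(\<Sum>v<n. deg n w v * (of_bool (v = i))\<^sup>2) = deg n w i"
      using i k by (subst sum_eq_single[of i]) auto
    show "(\<Sum>v<n. deg n w v * (of_bool (v = i))\<^sup>2) > 0" unfolding N using degpos[of i] i k by simp
    \<comment> \<open>Edges have distinct ends, so at most one indicator is nonzero and the cross
      term disappears.\<close>
    have "edge_sum n w (\<lambda>u v. (of_bool (u = i) + of_bool (v = i))\<^sup>2)
      = edge_sum n w (\<lambda>u v. (of_bool (u = i))\<^sup>2 + (of_bool (v = i))\<^sup>2)"
      unfolding edge_sum_def by (rule sum.cong) auto
    then show "edge_sum n w (\<lambda>u v. (of_bool (u = i) + of_bool (v = i))\<^sup>2)
      \<le> 1 * (\<Sum>v<n. deg n w v * (of_bool (v = i))\<^sup>2)"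
      unfolding deg_sum_edge_sum[OF G] by simp
  qed auto
  then show ?thesis by simp
qed

lemma odd_tent_sq:
  assumes "0 \<le> a"
  shows "(odd_part (tent a b) x)\<^sup>2 = (tent a b \<bar>x\<bar>)\<^sup>2"
proof -
  have z: "tent a b y = 0" if "y \<le> 0" for y using that assms by (simp add: tent_eq_0)
  show ?thesis
  proof (cases "0 \<le> x")
    case True
    then show ?thesis using z[of "- x"] by (simp add: odd_part_def)
  next
    case False
    then show ?thesis using z[of x] by (simp add: odd_part_def)
  qed
qed

lemma sum_squares_le_square_sum:
  fixes x :: "nat \<Rightarrow> real"
  assumes "\<And>i. 0 \<le> x i"
  shows "(\<Sum>i<m. (x i)\<^sup>2) \<le> (\<Sum>i<m. x i)\<^sup>2"
proof (induction m)
  case (Suc m)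
  have "0 \<le> (\<Sum>i<m. x i) * x m" by (intro mult_nonneg_nonneg sum_nonneg assms)
  then show ?case using Suc by (simp add: power2_sum)
qed simp

text \<open>Markov's inequality: at most \<open>k\<close> of the \<open>2 * k\<close> terms exceed
  \<open>E / k\<close>, so at least \<open>k\<close> remain.\<close>

lemma small_energy_indices:
  fixes e :: "nat \<Rightarrow> real"
  assumes "(\<Sum>i<2 * k. e i) \<le> E" "0 < E" "0 < k" "\<And>i. 0 \<le> e i"
  obtains \<sigma> where "inj_on \<sigma> {..<k}" "\<And>i. i < k \<Longrightarrow> \<sigma> i < 2 * k \<and> e (\<sigma> i) \<le> E / k"
proof -
  define J where "J = {i. i < 2 * k \<and> e i > E / k}"
  define I where "I = {i. i < 2 * k \<and> e i \<le> E / k}"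
  have fin: "finite I" "finite J" by (auto simp: I_def J_def)
  have "card J * (E / k) \<le> (\<Sum>i\<in>J. e i)"
    by (rule sum_bounded_below) (auto simp: J_def)
  also have "\<dots> \<le> (\<Sum>i<2 * k. e i)"
    by (rule sum_mono2) (use assms(4) in \<open>auto simp: J_def\<close>)
  also have "\<dots> \<le> E" by fact
  finally have "card J \<le> k" using assms(2,3) by (simp add: field_simps)
  moreover have "card I + card J = 2 * k"
  proof -
    have "I \<inter> J = {}" "I \<union> J = {..<2 * k}" by (auto simp: I_def J_def)
    then show ?thesis using card_Un_disjoint[OF fin] by simp
  qed
  ultimately have "card {..<k} \<le> card I" by simp
  then obtain \<sigma> where "\<sigma> ` {..<k} \<subseteq> I" "inj_on \<sigma> {..<k}" using card_le_inj[OF _ fin(1)] by blast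
  then show ?thesis using that[of \<sigma>] by (auto simp: I_def)
qed

text \<open>The thresholds with budget \<open>C\<close> for the squared norm of each truncation
  reach the top within \<open>2 * k\<close> steps, since otherwise \<open>k\<close> of the
  truncations would push the eigenvalue below itself. The norm bound is then \<open>2 * k\<close>
  budgets.\<close>

lemma zigzag_approximation:
  assumes G: "wgraph n w" and degpos: "\<And>v. v < n \<Longrightarrow> deg n w v \<ge> 1"
    and eig: "sorted_eigenvalues (signless_norm_mat n w) alphas"
    and k: "1 \<le> k" "k \<le> n"
    and alpha: "alpha = alphas ! (k - 1)" "0 < alpha"
    and E: "E = edge_sum n w (\<lambda>u v. (f u + f v)\<^sup>2)" "0 < E"
  obtains t where "mono t" "t 0 = 0" "\<And>v. v < n \<Longrightarrow> \<bar>f v\<bar> \<le> t (2 * k)"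
    "(\<Sum>v<n. deg n w v * (zigzag t (2 * k) \<bar>f v\<bar>)\<^sup>2) \<le> 8 * E / alpha"
proof -
  \<comment> \<open>Chosen so that \<open>E / k\<close> is \<open>alpha / 4\<close> times
    \<open>C\<close>: with the factor 2 for disjoint families this gives the contradictory bound
    \<open>alpha / 2\<close>.\<close>
  define C where "C = 4 * E / (k * alpha)"
  define M where "M = (\<Sum>v<n. \<bar>f v\<bar>)"
  define F where "F a b = (\<Sum>v<n. deg n w v * (tent a b \<bar>f v\<bar>)\<^sup>2)" for a b
  have C: "0 < C" using k alpha E by (simp add: C_def)
  have M: "\<bar>f v\<bar> \<le> M" if "v < n" for v unfolding M_def by (rule member_le_sum) (use that in auto)
  obtain t where t: "mono t" "t 0 = 0" "\<And>i. F (t i) (t (Suc i)) \<le> C"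
      "\<And>m. t m = M \<or> (\<forall>i<m. F (t i) (t (Suc i)) = C)"
  proof (rule greedy_thresholds[of F C M])
    show "continuous_on UNIV (F a)" for a
      unfolding F_def[abs_def] tent_def by (intro continuous_intros)
    have "F a a = 0" for a
      unfolding F_def by (rule sum.neutral) (simp add: tent_def min_def max_def)
    then show "F a a \<le> C" for a using C by simp
    show "0 \<le> M" unfolding M_def by (simp add: sum_nonneg)
  qed blast
  have t0: "0 \<le> t i" for i using monoD[OF t(1), of 0 i] t(2) by simp
  let ?g = "\<lambda>i x. odd_part (tent (t i) (t (Suc i))) x"
  have end_reached: "t (2 * k) = M"
  proof (rule ccontr)
    assume "t (2 * k) \<noteq> M"
    \<comment> \<open>The end was missed, so every step used its budget exactly, and all
      \<open>2 * k\<close> truncations have squared norm \<open>C\<close>.\<close>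
    then have FC: "F (t i) (t (Suc i)) = C" if "i < 2 * k" for i using t(4)[of "2 * k"] that by blast
    have norm: "(\<Sum>v<n. deg n w v * (?g i (f v))\<^sup>2) = C" if "i < 2 * k" for i
      using FC[OF that] by (simp add: F_def odd_tent_sq[OF t0])
    define e where "e i = edge_sum n w (\<lambda>u v. (?g i (f u) + ?g i (f v))\<^sup>2)" for i
    have "(\<Sum>i<2 * k. e i) \<le> E"
      unfolding e_def edge_sum_sum[symmetric] E(1)
    proof (rule edge_sum_mono[OF G])
      fix u v
      \<comment> \<open>Oddness turns the sum at \<open>f u\<close> and \<open>f v\<close> into a
        difference at \<open>f u\<close> and \<open>- f v\<close>, to which the joint variation
        bound applies.\<close>
      have neg: "?g i (f u) + ?g i (f v) = ?g i (f u) - ?g i (- f v)" for i by (simp add: odd_part_def)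
      have "(\<Sum>i<2 * k. (?g i (f u) + ?g i (f v))\<^sup>2) \<le> (\<Sum>i<2 * k. \<bar>?g i (f u) + ?g i (f v)\<bar>)\<^sup>2"
        using sum_squares_le_square_sum[of "\<lambda>i. \<bar>?g i (f u) + ?g i (f v)\<bar>" "2 * k"] by simp
      also have "\<dots> \<le> \<bar>f u - (- f v)\<bar>\<^sup>2"
        unfolding neg by (intro power_mono sum_odd_tents_diff_le[OF t(1,2)] sum_nonneg) simp
      finally show "(\<Sum>i<2 * k. (?g i (f u) + ?g i (f v))\<^sup>2) \<le> (f u + f v)\<^sup>2" by simp
    qed
    then obtain \<sigma> where \<sigma>: "inj_on \<sigma> {..<k}" "\<And>i. i < k \<Longrightarrow> \<sigma> i < 2 * k \<and> e (\<sigma> i) \<le> E / k"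
    proof (rule small_energy_indices)
      show "0 \<le> e i" for i unfolding e_def by (rule edge_sum_nonneg[OF G]) simp
    qed (use E(2) k in auto)
    have "alphas ! (k - 1) \<le> 2 * (alpha / 4)"
    proof (rule disjoint_functions_eigenvalue_le[OF G degpos eig k, where g = "\<lambda>i v. ?g (\<sigma> i) (f v)"])
      fix i assume i: "i < k"
      then have \<sigma>i: "\<sigma> i < 2 * k" "e (\<sigma> i) \<le> E / k" using \<sigma>(2) by auto
      show "0 < (\<Sum>v<n. deg n w v * (?g (\<sigma> i) (f v))\<^sup>2)" using norm[OF \<sigma>i(1)] C by simp
      have EC: "E / k = alpha / 4 * C" using alpha k by (simp add: C_def)
      show "edge_sum n w (\<lambda>u v. (?g (\<sigma> i) (f u) + ?g (\<sigma> i) (f v))\<^sup>2)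
          \<le> alpha / 4 * (\<Sum>v<n. deg n w v * (?g (\<sigma> i) (f v))\<^sup>2)"
        using \<sigma>i(2) unfolding e_def EC norm[OF \<sigma>i(1)] .
    next
      fix i j v assume "i < k" "j < k" "i \<noteq> j"
      then have "\<sigma> i \<noteq> \<sigma> j" using \<sigma>(1) by (auto simp: inj_on_def)
      then have "tent (t (\<sigma> i)) (t (Suc (\<sigma> i))) \<bar>f v\<bar> * tent (t (\<sigma> j)) (t (Suc (\<sigma> j))) \<bar>f v\<bar> = 0"
        by (rule tents_disjoint[OF t(1)])
      \<comment> \<open>Squaring removes the sign and carries disjointness over from the tents of
        \<open>\<bar>f v\<bar>\<close>.\<close>
      then have "(?g (\<sigma> i) (f v) * ?g (\<sigma> j) (f v))\<^sup>2 = 0"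
        unfolding power_mult_distrib odd_tent_sq[OF t0] by (simp add: power_mult_distrib[symmetric])
      then show "?g (\<sigma> i) (f v) * ?g (\<sigma> j) (f v) = 0" by simp
    qed
    then show False using alpha by simp
  qed
  have "(\<Sum>v<n. deg n w v * (zigzag t (2 * k) \<bar>f v\<bar>)\<^sup>2) = (\<Sum>i<2 * k. F (t i) (t (Suc i)))"
    unfolding zigzag_sq[OF t(1)] F_def sum_distrib_left by (rule sum.swap)
  also have "\<dots> \<le> of_nat (card {..<2 * k}) * C" by (rule sum_bounded_above) (rule t(3))
  also have "\<dots> = 8 * E / alpha" using k alpha by (simp add: C_def)
  finally show ?thesis using that[of t] t(1,2) M end_reached by simp
qed

text \<open>AM--GM weighted for \<open>s\<close> the square root of the eigenvalue: after summation
  with \<open>8 * E / s^2\<close> for the squares of \<open>p\<close> and \<open>q\<close>, both new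
  terms equal \<open>E / s\<close>.\<close>

lemma am_gm_cut:
  fixes d p q s :: real
  assumes "0 < s" "0 \<le> d"
  shows "d * (p + q + d) / 2 \<le> (1 / 2 + 1 / s) * d\<^sup>2 + s / 8 * (p\<^sup>2 + q\<^sup>2)"
proof -
  have "0 \<le> (4 * d / s - (p + q))\<^sup>2 * (s / 16) + (p - q)\<^sup>2 * (s / 16)"
    using assms by simp
  also have "\<dots> = d\<^sup>2 / s - d * (p + q) / 2 + s / 8 * (p\<^sup>2 + q\<^sup>2)"
    using assms by (simp add: power2_eq_square field_simps)
  finally show ?thesis by (simp add: power2_eq_square algebra_simps)
qed

text \<open>For positive energy, average the cuts with \<open>psi\<close> the antiderivative of
  \<open>zigzag\<close> and compare volume with numerator; zero energy is treated directly.\<close>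

lemma bip_fun_le_rayleigh:
  assumes G: "wgraph n w" and degpos: "\<And>v. v < n \<Longrightarrow> deg n w v \<ge> 1"
    and eig: "sorted_eigenvalues (signless_norm_mat n w) alphas"
    and fnz: "\<exists>v<n. f v \<noteq> 0"
    and k: "1 \<le> k" "k \<le> n"
    and ak: "alphas ! (k - 1) > 0"
  shows "bip_fun n w f \<le> 16 * sqrt 2 * real k * rayleigh_plus n w f / sqrt (alphas ! (k - 1))"
proof -
  define alpha s where "alpha = alphas ! (k - 1)" and "s = sqrt alpha"
  define E N where "E = edge_sum n w (\<lambda>u v. (f u + f v)\<^sup>2)" and "N = (\<Sum>v<n. deg n w v * (f v)\<^sup>2)"
  let ?b = "bip_fun n w f"
  have alpha: "0 < alpha" using ak by (simp add: alpha_def)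
  have s: "0 < s" "s * s = alpha" using alpha by (auto simp: s_def)
  have s2: "s \<le> sqrt 2" using eigenvalue_le_2[OF G degpos eig k] by (simp add: s_def alpha_def)
  have R: "rayleigh_plus n w f = E / N"
    by (simp add: rayleigh_plus_def E_def edge_sum_def N_def)
  obtain v0 where v0: "v0 < n" "f v0 \<noteq> 0" using fnz by blast
  have N: "0 < N" unfolding N_def
    by (rule sum_pos2[of _ v0]) (use v0 degpos[OF v0(1)] deg_nonneg[OF G] in auto)
  have E0: "0 \<le> E" unfolding E_def by (rule edge_sum_nonneg[OF G]) simp
  have b0: "0 \<le> ?b" by (rule bip_fun_nonneg[OF G fnz])
  show ?thesis
  proof (cases "E = 0")
    case True
    \<comment> \<open>With the identity on nonnegative values as weight, the kernel is
      \<open>\<bar>x + y\<bar>\<close>, which vanishes on every edge of positive weight when the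
      energy is 0. So the ratio itself is 0.\<close>
    have ker: "cut_kernel (max 0) x y = \<bar>x + y\<bar>" for x y
      by (subst cut_kernel_odd_part) (auto simp: odd_part_def max_def)
    have "edge_sum n w (\<lambda>u v. cut_kernel (max 0) (f u) (f v)) = 0"
    proof -
      have w: "0 \<le> w u v" for u v using G by (simp add: wgraph_def)
      have "\<forall>p\<in>{(u,v). u < n \<and> v < n \<and> u < v}. (case p of (u,v) \<Rightarrow> w u v * (f u + f v)\<^sup>2) = 0"
        using True unfolding E_def edge_sum_def
        by (subst (asm) sum_nonneg_eq_0_iff[OF finite_edges]) (auto simp: w)
      then show ?thesis unfolding edge_sum_def ker by (intro sum.neutral) auto
    qed
    moreover have "?b * (\<Sum>v<n. deg n w v * max 0 \<bar>f v\<bar>) \<le> edge_sum n w (\<lambda>u v. cut_kernel (max 0) (f u) (f v))"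
      by (rule bip_fun_le_cut_kernel[OF G degpos]) auto
    moreover have "0 < (\<Sum>v<n. deg n w v * max 0 \<bar>f v\<bar>)"
      by (rule sum_pos2[of _ v0]) (use v0 degpos[OF v0(1)] deg_nonneg[OF G] in auto)
    ultimately have "?b \<le> 0" by (simp add: mult_le_0_iff)
    then show ?thesis using True R by simp
  next
    case False
    then have E: "0 < E" using E0 by simp
    obtain t where t: "mono t" "t 0 = 0" "\<And>v. v < n \<Longrightarrow> \<bar>f v\<bar> \<le> t (2 * k)"
        "(\<Sum>v<n. deg n w v * (zigzag t (2 * k) \<bar>f v\<bar>)\<^sup>2) \<le> 8 * E / alpha"
      using zigzag_approximation[OF G degpos eig k alpha_def alpha E_def E] by blast
    let ?H = "zigzag_int t (2 * k)" let ?m = "\<lambda>v. zigzag t (2 * k) \<bar>f v\<bar>"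
    \<comment> \<open>The averaged volume bound: \<open>2 * k\<close> intervals turn
      \<open>4 * m\<close> into \<open>8 * k\<close>.\<close>
    have "?b * (N / (8 * k)) \<le> ?b * (\<Sum>v<n. deg n w v * ?H \<bar>f v\<bar>)"
    proof (rule mult_left_mono[OF _ b0])
      have "N / (8 * k) = (\<Sum>v<n. deg n w v * (\<bar>f v\<bar>\<^sup>2 / (4 * real (2 * k))))"
        by (simp add: N_def sum_divide_distrib)
      also have "\<dots> \<le> (\<Sum>v<n. deg n w v * ?H \<bar>f v\<bar>)"
        by (intro sum_mono mult_left_mono zigzag_int_ge[OF t(1,2)] deg_nonneg[OF G]) (use t(3) k in auto)
      finally show "N / (8 * k) \<le> (\<Sum>v<n. deg n w v * ?H \<bar>f v\<bar>)" .
    qed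
    also have "\<dots> \<le> edge_sum n w (\<lambda>u v. cut_kernel ?H (f u) (f v))"
      by (rule bip_fun_le_cut_kernel[OF G degpos])
        (use zigzag_int_mono[OF t(1)] zigzag_int_nonpos_eq_0[OF t(1,2)] in auto)
    also have "\<dots> \<le> edge_sum n w (\<lambda>u v. (1 / 2 + 1 / s) * (f u + f v)\<^sup>2 + s / 8 * ((?m u)\<^sup>2 + (?m v)\<^sup>2))"
    proof (rule edge_sum_mono[OF G])
      fix u v
      have "cut_kernel ?H (f u) (f v) = \<bar>odd_part ?H (f u) - odd_part ?H (- f v)\<bar>"
        by (rule cut_kernel_odd_part) (use zigzag_int_mono[OF t(1)] zigzag_int_nonpos_eq_0[OF t(1,2)] in auto)
      also have "\<dots> \<le> \<bar>f u + f v\<bar> * (?m u + ?m v + \<bar>f u + f v\<bar>) / 2"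
        using odd_zigzag_int_diff_le[OF t(1,2), of "2 * k" "f u" "- f v"] by simp
      also have "\<dots> \<le> (1 / 2 + 1 / s) * (f u + f v)\<^sup>2 + s / 8 * ((?m u)\<^sup>2 + (?m v)\<^sup>2)"
        using am_gm_cut[OF s(1), of "\<bar>f u + f v\<bar>"] by simp
      finally show "cut_kernel ?H (f u) (f v)
        \<le> (1 / 2 + 1 / s) * (f u + f v)\<^sup>2 + s / 8 * ((?m u)\<^sup>2 + (?m v)\<^sup>2)" .
    qed
    also have "\<dots> = (1 / 2 + 1 / s) * E + s / 8 * (\<Sum>v<n. deg n w v * (?m v)\<^sup>2)"
      by (simp only: edge_sum_add edge_sum_scale deg_sum_edge_sum[OF G] E_def)
    also have "\<dots> \<le> (1 / 2 + 1 / s) * E + s / 8 * (8 * E / alpha)"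
      using t(4) s(1) by (intro add_left_mono mult_left_mono) auto
    also have "\<dots> = (s + 4) * E / (2 * s)"
      using s(1) unfolding s(2)[symmetric] by (simp add: field_simps)
    also have "\<dots> \<le> (4 * sqrt 2) * E / (2 * s)"
    proof -
      \<comment> \<open>Since \<open>s \<le> sqrt 2\<close>, it suffices that
        \<open>sqrt 2 + 4 \<le> 4 * sqrt 2\<close>, that is, \<open>4 / 3 \<le> sqrt 2\<close>; the
        constant \<open>sqrt 2\<close> of the theorem arises here.\<close>
      have "4 / 3 \<le> sqrt 2" by (rule real_le_rsqrt) (simp add: power2_eq_square)
      then have "s + 4 \<le> 4 * sqrt 2" using s2 by linarith
      then show ?thesis using E s(1) by (intro divide_right_mono mult_right_mono) auto
    qed
    finally have "?b * (N / (8 * k)) \<le> (4 * sqrt 2) * E / (2 * s)" .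
    then have "?b \<le> (4 * sqrt 2) * E / (2 * s) / (N / (8 * k))"
      using N k by (subst pos_le_divide_eq) auto
    also have "\<dots> = 16 * sqrt 2 * k * (E / N) / s" using N k s(1) by (simp add: field_simps)
    finally show ?thesis unfolding R by (simp add: s_def alpha_def)
  qed
qed

text \<open>The test function is not the first eigenvector itself but its quotient by the square
  roots of the degrees, which identifies the Rayleigh quotient with that of the matrix.\<close>

lemma smallest_eigenvalue_rayleigh:
  assumes G: "wgraph n w" and degpos: "\<And>v. v < n \<Longrightarrow> deg n w v \<ge> 1"
    and eig: "sorted_eigenvalues (signless_norm_mat n w) alphas"
    and n: "0 < n"
  obtains \<phi> where "\<exists>v<n. \<phi> v \<noteq> 0" "rayleigh_plus n w \<phi> = alphas ! 0"
proof -
  have cp: "char_poly (mat n n (\<lambda>(i,j). signless_entry n w i j)) = (\<Prod>e\<leftarrow>alphas. [:- e, 1:])"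
    using eig by (simp add: sorted_eigenvalues_def signless_norm_mat_eq)
  obtain q where eigen: "\<And>j i. j < n \<Longrightarrow> i < n \<Longrightarrow> (\<Sum>l<n. signless_entry n w i l * q j l) = alphas ! j * q j i"
    and "\<And>i j. i < n \<Longrightarrow> j < n \<Longrightarrow> i \<noteq> j \<Longrightarrow> ip n (q i) (q j) = 0"
    and pos: "\<And>j. j < n \<Longrightarrow> ip n (q j) (q j) > 0"
    and "\<And>x. x \<in> lspan n q n"
    by (rule symmetric_orthogonal_eigenbasis[OF signless_entry_sym[OF G] cp]) (rule that)
  note q = eigen[OF n] pos[OF n]
  define \<phi> where "\<phi> v = q 0 v / sqrt (deg n w v)" for v
  let ?x = "\<lambda>v. sqrt (deg n w v) * \<phi> v"
  have x: "?x v = q 0 v" if "v < n" for v using degpos[OF that] by (simp add: \<phi>_def)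
  have xx: "(\<Sum>v<n. deg n w v * (\<phi> v)\<^sup>2) = ip n (q 0) (q 0)"
    unfolding ip_weighted[OF G, symmetric] by (rule ip_cong) (use x in auto)
  have "edge_sum n w (\<lambda>u v. (\<phi> u + \<phi> v)\<^sup>2) = ip n ?x (\<lambda>i. \<Sum>j<n. signless_entry n w i j * ?x j)"
    by (subst signless_quadratic_form[OF G degpos]) simp_all
  also have "\<dots> = ip n (q 0) (\<lambda>i. alphas ! 0 * q 0 i)"
  proof (rule ip_cong)
    fix i assume "i < n"
    have "(\<Sum>j<n. signless_entry n w i j * ?x j) = (\<Sum>l<n. signless_entry n w i l * q 0 l)"
      by (rule sum.cong) (use x in auto)
    then show "(\<Sum>j<n. signless_entry n w i j * ?x j) = alphas ! 0 * q 0 i" using q(1) \<open>i < n\<close> by simp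
  qed (rule x)
  finally have "rayleigh_plus n w \<phi> = alphas ! 0"
    unfolding rayleigh_plus_def edge_sum_def[symmetric] xx ip_scale_right using q(2) by simp
  moreover have "\<exists>v<n. \<phi> v \<noteq> 0"
  proof (rule ccontr)
    assume "\<not> ?thesis"
    then have "(\<Sum>v<n. deg n w v * (\<phi> v)\<^sup>2) = 0" by (intro sum.neutral) auto
    then show False using xx q(2) by simp
  qed
  ultimately show ?thesis using that by blast
qed

theorem mainTheorem11:
  fixes n :: nat and w :: "nat \<Rightarrow> nat \<Rightarrow> real" and alphas :: "real list"
    and f :: "nat \<Rightarrow> real" and k :: nat
  assumes G: "wgraph n w"
    and degpos: "\<And>v. v < n \<Longrightarrow> deg n w v \<ge> 1"
    and eig: "sorted_eigenvalues (signless_norm_mat n w) alphas"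
    and fnz: "\<exists>v<n. f v \<noteq> 0"
    and k: "1 \<le> k" "k \<le> n"
    and ak: "alphas ! (k - 1) > 0"
  shows "bip_fun n w f \<le> 16 * sqrt 2 * real k * rayleigh_plus n w f / sqrt (alphas ! (k - 1))
         \<and> bip_graph n w \<le> 16 * sqrt 2 * real k * (alphas ! 0) / sqrt (alphas ! (k - 1))"
proof
  show "bip_fun n w f \<le> 16 * sqrt 2 * real k * rayleigh_plus n w f / sqrt (alphas ! (k - 1))"
    by (rule bip_fun_le_rayleigh[OF G degpos eig fnz k ak])
  obtain \<phi> where \<phi>: "\<exists>v<n. \<phi> v \<noteq> 0" "rayleigh_plus n w \<phi> = alphas ! 0"
    using smallest_eigenvalue_rayleigh[OF G degpos eig] k by auto
  have "bip_graph n w \<le> bip_fun n w \<phi>" by (rule bip_graph_le_bip_fun[OF G \<phi>(1)])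
  also have "\<dots> \<le> 16 * sqrt 2 * real k * (alphas ! 0) / sqrt (alphas ! (k - 1))"
    using bip_fun_le_rayleigh[OF G degpos eig \<phi>(1) k ak] \<phi>(2) by simp
  finally show "bip_graph n w \<le> 16 * sqrt 2 * real k * (alphas ! 0) / sqrt (alphas ! (k - 1))" .
qed

end
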